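(* Let $(X_i,Y_i)$, $i\ge 1$, be i.i.d. copies of $(X,Y)$ with joint distribution function $F$ as in the context, and suppose that the second order condition (SO) stated in the context holds and that $\lim_{t\to\infty} t\,\alpha(t)=\lambda$ exists and is finite. Let $k=k(n)$ and let $r(n)=n\,\alpha(n/k)$ be a sequence of positive integers such that $r(n)\to\infty$ and $n/k\to\infty$ as $n\to\infty$, and put $m=[r(n)]$. Assume that $\sqrt{m}\,B(n/m)\to 0$ as $n\to\infty$, where $B$ is the auxiliary function in the second order condition for $V^\star$ stated in the context (the relation equivalent to (SO) for $x=y$). Then, for every $q>0$ in the class of estimators below, the estimator $$\hat\eta_q^{(S)}=\frac{1-\Bigl\{\frac1m\sum_{i=0}^{m-1}\bigl(Z_{n,n-i}/Z_{n,n-m}\bigr)^{1-1/q}\Bigr\}^{-1}}{1-1/q}$$ is asymptotically equivalent to its standard Pareto analogue $$\hat\eta_q=\frac{1-\Bigl\{\frac1m\sum_{i=0}^{m-1}\bigl(T_{n,n-i}/T_{n,n-m}\bigr)^{1-1/q}\Bigr\}^{-1}}{1-1/q},$$ in the sense that, as $n\to\infty$, $$\sqrt m\,\bigl|\hat\eta_q^{(S)}-\hat\eta_q\bigr|\ \longrightarrow\ 0\quad\text{in probability}.$$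
   Context: Notation: $\vee$ = maximum, $\wedge$ = minimum, $[a]$ = integer part of $a$, $f^{\leftarrow}$ = generalised inverse; $g\in RV_\alpha$ means $g(tx)/g(t)\to x^\alpha$ as $t\to\infty$ for all $x>0$. Setting: $(X,Y)$ has joint distribution function $F$ with continuous marginals $F_1,F_2$, and $F$ belongs to the max-domain of attraction of a bivariate extreme value distribution. With $V_i=(1/(-\log F_i))^{\leftarrow}$, $i=1,2$, the limit $R(x,y)=\lim_{t\to\infty}t\,P\{X>V_1(t/x-1/2),\,Y>V_2(t/y-1/2)\}$ exists. The function $\alpha$ is $$\alpha(t)=P\Bigl\{\tfrac{1}{-\log F_1(X)}+\tfrac12>t,\ \tfrac1{-\log F_2(Y)}+\tfrac12>t\Bigr\}.$$ Condition (SO): $\alpha(t)\to 0$ as $t\to\infty$, and there is a function $\beta$, ultimately of constant sign and tending to $0$, such that $$\lim_{t\to\infty}\frac{\dfrac{P\{\frac1{1-F_1(X)}>t/x,\ \frac1{1-F_2(Y)}>t/y\}}{\alpha(t)}-c(x,y)}{\beta(t)}=K(x,y)$$ exists for all $x,y\ge0$, $x+y>0$, with $K$ neither constant nor a multiple of $c$, the convergence being uniform on $\{(x,y)\in[0,\infty)^2: x^2+y^2=1\}$. Here $c(1,1)=1$, $c(x,x)=x^{1/\eta}$ and $K(x,x)=x^{1/\eta}\frac{x^{\tau/\eta}-1}{\eta\tau}$ for $x>0$, with residual dependence index $\eta\in(0,1]$ and second order parameter $\tau\ge0$ (case $\tau=0$ by continuity); in particular $\alpha\in RV_{-1/\eta}$.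 Let $Z=\frac1{(-\log F_1(X))\vee(-\log F_2(Y))}+\frac12$, with distribution function $F_Z$, and let $V^\star(t)=\frac12+\bigl(-1/\log F_Z\bigr)^{\leftarrow}(t)$. The second order condition for $V^\star$ is: for all $x>0$, $$\lim_{t\to\infty}\frac{\frac{V^\star(tx)}{V^\star(t)}-x^\eta}{B(t)}=x^\eta\,\frac{x^{-\tau_\star}-1}{\tau_\star},$$ where $B(t)\to0$, $|B|\in RV_{-\tau_\star}$ and $\tau_\star=\eta\wedge\tau\ge0$. Pseudo-observables: with $R(X_i)=\sum_{j=1}^n \mathbf 1\{X_j\le X_i\}$ and $R(Y_i)$ defined analogously (ranks), $$Z_i^{(n)}=\Bigl\{\bigl(-\log\tfrac{R(X_i)}{n+1}\bigr)\vee\bigl(-\log\tfrac{R(Y_i)}{n+1}\bigr)\Bigr\}^{-1}+\tfrac12,\qquad T_i^{(n)}=\tfrac{n+1}{n+1-R(X_i)}\wedge\tfrac{n+1}{n+1-R(Y_i)}.$$ $Z_{n,1}\le\dots\le Z_{n,n}$ and $T_{n,1}\le\dots\le T_{n,n}$ are the ascending order statistics of $Z_1^{(n)},\dots,Z_n^{(n)}$ and $T_1^{(n)},\dots,T_n^{(n)}$. In the class of estimators, $q>0$ and $p\in\mathbb R$ are conjugate constants, $1/p+1/q=1$; the case $q=1$ is understood as the limit $q\to1$, which gives the Hill estimator, $\frac1m\sum_{i=0}^{m-1}\log(Z_{n,n-i}/Z_{n,n-m})$ (respectively with $T$). *)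

theory Defs
  imports "HOL-Probability.Probability"
begin

section \<open>Generalised inverses, regular variation, convergence in probability\<close>

text \<open>
  The extended-real function \<open>-log\<close> on \<open>[0,1]\<close>, with \<open>-log 0 = \<infinity>\<close> (the library has
  \<open>ln 0 = 0\<close>).  In \<open>ereal\<close>, \<open>1 / 0 = \<infinity>\<close> and \<open>1 / \<infinity> = 0\<close>, so that
  \<open>1 / neg_log u\<close> is the usual \<open>1 / (-log u)\<close> on all of \<open>[0,1]\<close>.
\<close>
definition neg_log :: "real \<Rightarrow> ereal" where
  "neg_log u = (if u \<le> 0 then \<infinity> else ereal (- ln u))"

text \<open>
  Left-continuous inverse of a nondecreasing function.  The infimum is taken in \<open>real\<close>; for the
  functions \<open>1 / neg_log (F x)\<close>, \<open>F\<close> a distribution function, it is meaningful for \<open>t > 0\<close>,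
  and the inverses are only used for \<open>t \<rightarrow> \<infinity>\<close>.
\<close>
definition gen_inverse :: "(real \<Rightarrow> ereal) \<Rightarrow> real \<Rightarrow> real" where
  "gen_inverse f t = Inf {x. ereal t \<le> f x}"

definition regularly_varying :: "(real \<Rightarrow> real) \<Rightarrow> real \<Rightarrow> bool" where
  "regularly_varying g a \<longleftrightarrow> (\<forall>x>0. ((\<lambda>t. g (t * x) / g t) \<longlongrightarrow> x powr a) at_top)"

definition converges_in_prob :: "'a measure \<Rightarrow> (nat \<Rightarrow> 'a \<Rightarrow> real) \<Rightarrow> real \<Rightarrow> bool" where
  "converges_in_prob M U c \<longleftrightarrow>
     (\<forall>\<epsilon>>0. (\<lambda>n. measure M {\<omega> \<in> space M. \<bar>U n \<omega> - c\<bar> > \<epsilon>}) \<longlonglongrightarrow> 0)"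

section \<open>Bivariate max-domains of attraction\<close>

definition joint_law :: "'a measure \<Rightarrow> ('a \<Rightarrow> real) \<Rightarrow> ('a \<Rightarrow> real) \<Rightarrow> (real \<times> real) measure" where
  "joint_law M X Y = distr M borel (\<lambda>\<omega>. (X \<omega>, Y \<omega>))"

definition joint_cdf :: "(real \<times> real) measure \<Rightarrow> real \<Rightarrow> real \<Rightarrow> real" where
  "joint_cdf \<mu> x y = measure \<mu> ({..x} \<times> {..y})"

definition nondegenerate_margins :: "(real \<times> real) measure \<Rightarrow> bool" where
  "nondegenerate_margins \<mu> \<longleftrightarrow>
     \<not> (\<exists>a. measure \<mu> ({a} \<times> UNIV) = 1) \<and> \<not> (\<exists>a. measure \<mu> (UNIV \<times> {a}) = 1)"

text \<open>Weak convergence of normalised componentwise maxima of independent draws from \<open>\<mu>\<close> to \<open>\<nu>\<close>.\<close>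
definition maxima_converge :: "(real \<times> real) measure \<Rightarrow> (real \<times> real) measure \<Rightarrow> bool" where
  "maxima_converge \<mu> \<nu> \<longleftrightarrow>
     (\<exists>a b c d :: nat \<Rightarrow> real. (\<forall>n. a n > 0 \<and> c n > 0) \<and>
       (\<forall>x y. isCont (\<lambda>(u, v). joint_cdf \<nu> u v) (x, y) \<longrightarrow>
         (\<lambda>n. joint_cdf \<mu> (a n * x + b n) (c n * y + d n) ^ n) \<longlonglongrightarrow> joint_cdf \<nu> x y))"

text \<open>
  Bivariate extreme value distributions are the possible limit laws with nondegenerate margins.
\<close>
definition bivariate_evd :: "(real \<times> real) measure \<Rightarrow> bool" where
  "bivariate_evd \<nu> \<longleftrightarrow> prob_space \<nu> \<and> sets \<nu> = sets borel \<and> nondegenerate_margins \<nu> \<and>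
     (\<exists>\<mu>. prob_space \<mu> \<and> sets \<mu> = sets borel \<and> maxima_converge \<mu> \<nu>)"

definition in_max_domain_of_attraction :: "(real \<times> real) measure \<Rightarrow> bool" where
  "in_max_domain_of_attraction \<mu> \<longleftrightarrow> (\<exists>\<nu>. bivariate_evd \<nu> \<and> maxima_converge \<mu> \<nu>)"

section \<open>Population quantities\<close>

abbreviation marginal_cdf :: "'a measure \<Rightarrow> ('a \<Rightarrow> real) \<Rightarrow> real \<Rightarrow> real" where
  "marginal_cdf M X \<equiv> cdf (distr M borel X)"

definition V_marg :: "'a measure \<Rightarrow> ('a \<Rightarrow> real) \<Rightarrow> real \<Rightarrow> real" where
  "V_marg M X = gen_inverse (\<lambda>x. 1 / neg_log (marginal_cdf M X x))"

text \<open>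
  Only \<open>x, y > 0\<close> is required: for \<open>x = 0\<close> or \<open>y = 0\<close> the threshold is the right endpoint of the
  marginal distribution, which is exceeded with probability zero.
\<close>
definition limit_R ::
  "'a measure \<Rightarrow> ('a \<Rightarrow> real) \<Rightarrow> ('a \<Rightarrow> real) \<Rightarrow> (real \<Rightarrow> real \<Rightarrow> real) \<Rightarrow> bool" where
  "limit_R M X Y R \<longleftrightarrow> (\<forall>x>0. \<forall>y>0.
     ((\<lambda>t. t * measure M {\<omega> \<in> space M.
         X \<omega> > V_marg M X (t / x - 1 / 2) \<and> Y \<omega> > V_marg M Y (t / y - 1 / 2)}) \<longlongrightarrow> R x y) at_top)"

definition alpha :: "'a measure \<Rightarrow> ('a \<Rightarrow> real) \<Rightarrow> ('a \<Rightarrow> real) \<Rightarrow> real \<Rightarrow> real" where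
  "alpha M X Y t = measure M {\<omega> \<in> space M.
     1 / neg_log (marginal_cdf M X (X \<omega>)) + ereal (1 / 2) > ereal t \<and>
     1 / neg_log (marginal_cdf M Y (Y \<omega>)) + ereal (1 / 2) > ereal t}"

text \<open>
  Division is taken in \<open>ereal\<close>, so for \<open>t > 0\<close> we have \<open>t / 0 = \<infinity>\<close> and the probability
  vanishes when \<open>x = 0\<close> or \<open>y = 0\<close>.
\<close>
definition pareto_tail ::
  "'a measure \<Rightarrow> ('a \<Rightarrow> real) \<Rightarrow> ('a \<Rightarrow> real) \<Rightarrow> real \<Rightarrow> real \<Rightarrow> real \<Rightarrow> real" where
  "pareto_tail M X Y t x y = measure M {\<omega> \<in> space M.
     1 / ereal (1 - marginal_cdf M X (X \<omega>)) > ereal t / ereal x \<and>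
     1 / ereal (1 - marginal_cdf M Y (Y \<omega>)) > ereal t / ereal y}"

definition SO ::
  "'a measure \<Rightarrow> ('a \<Rightarrow> real) \<Rightarrow> ('a \<Rightarrow> real) \<Rightarrow> (real \<Rightarrow> real \<Rightarrow> real) \<Rightarrow> (real \<Rightarrow> real \<Rightarrow> real)
    \<Rightarrow> (real \<Rightarrow> real) \<Rightarrow> real \<Rightarrow> real \<Rightarrow> bool" where
  "SO M X Y c K \<beta> \<eta> \<tau> \<longleftrightarrow>
     (alpha M X Y \<longlongrightarrow> 0) at_top \<and>
     ((\<forall>\<^sub>F t in at_top. \<beta> t > 0) \<or> (\<forall>\<^sub>F t in at_top. \<beta> t < 0)) \<and>
     (\<beta> \<longlongrightarrow> 0) at_top \<and>
     (\<forall>x\<ge>0. \<forall>y\<ge>0. x + y > 0 \<longrightarrow>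
       ((\<lambda>t. (pareto_tail M X Y t x y / alpha M X Y t - c x y) / \<beta> t) \<longlongrightarrow> K x y) at_top) \<and>
     uniform_limit {(x, y). 0 \<le> x \<and> 0 \<le> y \<and> x\<^sup>2 + y\<^sup>2 = 1}
       (\<lambda>t (x, y). (pareto_tail M X Y t x y / alpha M X Y t - c x y) / \<beta> t)
       (\<lambda>(x, y). K x y) at_top \<and>
     \<not> (\<exists>a. \<forall>x\<ge>0. \<forall>y\<ge>0. x + y > 0 \<longrightarrow> K x y = a) \<and>
     \<not> (\<exists>a. \<forall>x\<ge>0. \<forall>y\<ge>0. x + y > 0 \<longrightarrow> K x y = a * c x y) \<and>
     0 < \<eta> \<and> \<eta> \<le> 1 \<and> 0 \<le> \<tau> \<and>
     c 1 1 = 1 \<and>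
     (\<forall>x>0. c x x = x powr (1 / \<eta>)) \<and>
     (\<forall>x>0. K x x = x powr (1 / \<eta>) *
        (if \<tau> = 0 then ln x / \<eta>\<^sup>2 else (x powr (\<tau> / \<eta>) - 1) / (\<eta> * \<tau>)))"

definition Z_var :: "'a measure \<Rightarrow> ('a \<Rightarrow> real) \<Rightarrow> ('a \<Rightarrow> real) \<Rightarrow> 'a \<Rightarrow> ereal" where
  "Z_var M X Y \<omega> =
     1 / max (neg_log (marginal_cdf M X (X \<omega>))) (neg_log (marginal_cdf M Y (Y \<omega>))) + ereal (1 / 2)"

definition F_Z :: "'a measure \<Rightarrow> ('a \<Rightarrow> real) \<Rightarrow> ('a \<Rightarrow> real) \<Rightarrow> real \<Rightarrow> real" where
  "F_Z M X Y z = measure M {\<omega> \<in> space M. Z_var M X Y \<omega> \<le> ereal z}"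

definition V_star :: "'a measure \<Rightarrow> ('a \<Rightarrow> real) \<Rightarrow> ('a \<Rightarrow> real) \<Rightarrow> real \<Rightarrow> real" where
  "V_star M X Y t = 1 / 2 + gen_inverse (\<lambda>z. 1 / neg_log (F_Z M X Y z)) t"

text \<open>For \<open>\<tau>\<^sub>\<star> = 0\<close> the right-hand side is read by continuity.\<close>
definition second_order_V_star ::
  "'a measure \<Rightarrow> ('a \<Rightarrow> real) \<Rightarrow> ('a \<Rightarrow> real) \<Rightarrow> (real \<Rightarrow> real) \<Rightarrow> real \<Rightarrow> real \<Rightarrow> bool" where
  "second_order_V_star M X Y B \<eta> \<tau>s \<longleftrightarrow>
     (\<forall>x>0. ((\<lambda>t. (V_star M X Y (t * x) / V_star M X Y t - x powr \<eta>) / B t) \<longlongrightarrow>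
        x powr \<eta> * (if \<tau>s = 0 then - ln x else (x powr (- \<tau>s) - 1) / \<tau>s)) at_top) \<and>
     (B \<longlongrightarrow> 0) at_top \<and> regularly_varying (\<lambda>t. \<bar>B t\<bar>) (- \<tau>s)"

section \<open>Pseudo-observables and estimators\<close>

text \<open>Samples are functions \<open>nat \<Rightarrow> real\<close> of which the entries \<open>1, \<dots>, n\<close> are used.\<close>
definition sample_rank :: "nat \<Rightarrow> (nat \<Rightarrow> real) \<Rightarrow> nat \<Rightarrow> nat" where
  "sample_rank n x i = (\<Sum>j=1..n. of_bool (x j \<le> x i))"

definition pseudo_Z :: "nat \<Rightarrow> (nat \<Rightarrow> real) \<Rightarrow> (nat \<Rightarrow> real) \<Rightarrow> nat \<Rightarrow> real" where
  "pseudo_Z n x y i =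
     inverse (max (- ln (real (sample_rank n x i) / (real n + 1)))
                  (- ln (real (sample_rank n y i) / (real n + 1)))) + 1 / 2"

definition pseudo_T :: "nat \<Rightarrow> (nat \<Rightarrow> real) \<Rightarrow> (nat \<Rightarrow> real) \<Rightarrow> nat \<Rightarrow> real" where
  "pseudo_T n x y i =
     min ((real n + 1) / (real n + 1 - real (sample_rank n x i)))
         ((real n + 1) / (real n + 1 - real (sample_rank n y i)))"

text \<open>The \<open>j\<close>-th smallest among \<open>z 1, \<dots>, z n\<close>, for \<open>1 \<le> j \<le> n\<close>.\<close>
definition order_stat :: "nat \<Rightarrow> (nat \<Rightarrow> real) \<Rightarrow> nat \<Rightarrow> real" where
  "order_stat n z j = sort (map z [1..<Suc n]) ! (j - 1)"

text \<open>
  The case \<open>q = 1\<close> is the limit \<open>q \<rightarrow> 1\<close>, the Hill estimator.  The conjugate constant \<open>p\<close> enters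
  only through \<open>1/p = 1 - 1/q\<close>.
\<close>
definition eta_estimator :: "real \<Rightarrow> nat \<Rightarrow> nat \<Rightarrow> (nat \<Rightarrow> real) \<Rightarrow> real" where
  "eta_estimator q n m z =
     (if q = 1
      then (1 / real m) * (\<Sum>i<m. ln (order_stat n z (n - i) / order_stat n z (n - m)))
      else (1 - inverse ((1 / real m) *
              (\<Sum>i<m. (order_stat n z (n - i) / order_stat n z (n - m)) powr (1 - 1 / q))))
           / (1 - 1 / q))"

end

theory Submission
  imports Defs
begin

text \<open>
  Both pseudo-observables are functions of the same quantity, the smaller of the two relative ranks
  \<open>u\<close>: \<open>T = 1 / (1 - u)\<close> and \<open>Z = 1 / (- ln u) + 1 / 2\<close>.  Hence \<open>Z\<close> is an increasing function of
  \<open>T\<close> (\<open>pseudo_Z_eq\<close>), and the order statistics of the \<open>Z\<close>'s are the images of those of the \<open>T\<close>'s.  The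
  shift \<open>1 / 2\<close> is chosen so that the constant term in the expansion \<open>Z = T - 1 / (12 T) + \<dots>\<close> vanishes;
  the relative error is therefore of order \<open>T\<^sup>-\<^sup>2\<close> rather than \<open>T\<^sup>-\<^sup>1\<close>.  As all order statistics that
  enter an estimator are at least \<open>T\<^sub>n\<^sub>,\<^sub>n\<^sub>-\<^sub>m\<close>, the two estimators differ by at most a constant times
  \<open>1 / (T\<^sub>n\<^sub>,\<^sub>n\<^sub>-\<^sub>m)\<^sup>2\<close>, provided that the averages which they invert stay away from \<open>0\<close>.  That is automatic for
  \<open>q \<ge> 1\<close>; for \<open>q < 1\<close> it suffices that half of the ratios are bounded, i.e. that
  \<open>T\<^sub>n\<^sub>,\<^sub>n\<^sub>-\<^sub>j / T\<^sub>n\<^sub>,\<^sub>n\<^sub>-\<^sub>m\<close> with \<open>j = m div 2\<close> is bounded (\<open>estimator_difference_bound\<close>).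

  It remains to locate two order statistics and to compare scales.  Put \<open>s = n / k\<close>, so that
  \<open>m = n \<alpha>(s)\<close>.

  The first task is probabilistic.  Ranks are compared with the true marginal distribution
  functions by counting how many observations exceed a marginal quantile, and how many pairs exceed
  two of them jointly.  These counts are binomial with means tending to infinity, so Chebyshev's
  inequality makes them equal to their means up to a factor between \<open>3/4\<close> and \<open>5/4\<close>.  By (SO) the joint
  tail probability at level \<open>s / x\<close> is asymptotically \<open>x\<^sup>1\<^sup>/\<^sup>\<eta> \<alpha>(s)\<close>, and \<open>x = 4\<close> and \<open>x = 1/8\<close>
  give \<open>T\<^sub>n\<^sub>,\<^sub>n\<^sub>-\<^sub>m > s / 8\<close> and \<open>T\<^sub>n\<^sub>,\<^sub>n\<^sub>-\<^sub>j \<le> 16 s\<close>, with probability tending to one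
  (\<open>order_stats_pseudo_T_bounds\<close>).

  The second task is analytic: \<open>\<surd>m / s\<^sup>2 \<longrightarrow> 0\<close>.  By hypothesis \<open>\<surd>m B(n/m) \<longrightarrow> 0\<close>, so it is enough that
  \<open>s\<^sup>-\<^sup>2 = O(B(n/m))\<close>.  As \<open>\<alpha>(s) = m / n\<close>, the threshold \<open>s\<close> is at least \<open>V\<^sup>\<star>(n/m - 1) - 1/2\<close>, and \<open>V\<^sup>\<star>\<close>
  varies regularly with index \<open>\<eta>\<close>.  So \<open>s\<^sup>-\<^sup>2\<close> is roughly of order at most \<open>(n/m)\<^sup>-\<^sup>2\<^sup>\<eta>\<close>, whereas \<open>|B|\<close>
  has index \<open>- min \<eta> \<tau> \<ge> - \<eta>\<close>; the gap between \<open>\<eta>\<close> and \<open>2 \<eta>\<close> absorbs the slowly varying factors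
  (\<open>sqrt_over_threshold_square_tendsto_0\<close>).
\<close>

section \<open>Frechet and Pareto scales differ at second order only\<close>

text \<open>
  The two bounds on the logarithm are the rational functions obtained by inverting \<open>1/v - 1/2\<close> and
  \<open>1/v - 1/2 - v\<close>, which is the form in which they bound \<open>frechet_of_pareto\<close>.
\<close>
lemma neg_ln_one_minus_lower:
  fixes v :: real
  assumes "0 < v" "v < 1"
  shows "2 * v / (2 - v) \<le> - ln (1 - v)"
proof -
  define f where "f = (\<lambda>x::real. - ln (1 - x) - 2 * x / (2 - x))"
  have "f 0 \<le> f v"
  proof (rule DERIV_nonneg_imp_nondecreasing[of 0 v f])
    show "0 \<le> v" using assms by simp
    fix x assume x: "0 \<le> x" "x \<le> v"
    have eq: "- ((0 - 1) / (1 - x)) - ((2 * 1) * (2 - x) - 2 * x * (0 - 1)) / ((2 - x) * (2 - x))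
        = 1 / (1 - x) - 4 / (2 - x)\<^sup>2"
      by (simp add: power2_eq_square algebra_simps)
    have "(f has_real_derivative (1 / (1 - x) - 4 / (2 - x)\<^sup>2)) (at x)"
      unfolding f_def eq[symmetric] using x assms by (auto intro!: derivative_eq_intros)
    moreover have "4 / (2 - x)\<^sup>2 \<le> 1 / (1 - x)"
    proof -
      have "4 * (1 - x) \<le> (2 - x)\<^sup>2" by (simp add: power2_eq_square algebra_simps)
      then show ?thesis using x assms by (simp add: divide_simps)
    qed
    ultimately show "\<exists>y. (f has_real_derivative y) (at x) \<and> 0 \<le> y" by force
  qed
  then show ?thesis by (simp add: f_def)
qed

lemma neg_ln_one_minus_upper:
  fixes v :: real
  assumes "0 < v" "v \<le> 1 / 2"
  shows "- ln (1 - v) \<le> 2 * v / (2 - v - 2 * v\<^sup>2)"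
proof -
  define f where "f = (\<lambda>x::real. 2 * x / (2 - x - 2 * x\<^sup>2) + ln (1 - x))"
  have "f 0 \<le> f v"
  proof (rule DERIV_nonneg_imp_nondecreasing[of 0 v f])
    show "0 \<le> v" using assms by simp
    fix x assume x: "0 \<le> x" "x \<le> v"
    have x2: "x\<^sup>2 \<le> x * (1/2)" unfolding power2_eq_square using x assms by (intro mult_left_mono) auto
    then have pos: "2 - x - 2 * x\<^sup>2 > 0" using x assms by linarith
    have eq: "((2 * 1) * (2 - x - 2 * x\<^sup>2) - 2 * x * (0 - 1 - 2 * (2 * x))) / ((2 - x - 2 * x\<^sup>2) * (2 - x - 2 * x\<^sup>2))
          + (0 - 1) / (1 - x)
        = (4 + 4 * x\<^sup>2) / (2 - x - 2 * x\<^sup>2)\<^sup>2 - 1 / (1 - x)"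
      by (simp add: power2_eq_square algebra_simps)
    have "(f has_real_derivative ((4 + 4 * x\<^sup>2) / (2 - x - 2 * x\<^sup>2)\<^sup>2 - 1 / (1 - x))) (at x)"
      unfolding f_def eq[symmetric] using x assms pos by (auto intro!: derivative_eq_intros)
    moreover have "1 / (1 - x) \<le> (4 + 4 * x\<^sup>2) / (2 - x - 2 * x\<^sup>2)\<^sup>2"
    proof -
      have "0 \<le> x\<^sup>2 * (11 - 8 * x - 4 * x\<^sup>2)"
        using x2 x assms by (intro mult_nonneg_nonneg) auto
      then have "(2 - x - 2 * x\<^sup>2)\<^sup>2 \<le> (4 + 4 * x\<^sup>2) * (1 - x)"
        by (simp add: power2_eq_square algebra_simps)
      then show ?thesis using x assms pos by (simp add: divide_simps)
    qed
    ultimately show "\<exists>y. (f has_real_derivative y) (at x) \<and> 0 \<le> y" by force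
  qed
  then show ?thesis by (simp add: f_def)
qed

text \<open>
  If \<open>U\<close> is uniform on \<open>(0, 1)\<close>, this map turns the standard Pareto variable \<open>1 / (1 - U)\<close> into the standard
  Frechet variable \<open>1 / (- ln U)\<close>, shifted by \<open>1 / 2\<close>.
\<close>
definition frechet_of_pareto :: "real \<Rightarrow> real" where
  "frechet_of_pareto t = inverse (- ln (1 - 1 / t)) + 1 / 2"

lemma frechet_of_pareto_le:
  assumes "1 < t" shows "frechet_of_pareto t \<le> t"
proof -
  have "2 * (1 / t) / (2 - 1 / t) \<le> - ln (1 - 1 / t)"
    by (rule neg_ln_one_minus_lower) (use assms in auto)
  moreover have pos: "2 * (1 / t) / (2 - 1 / t) > 0" using assms by (simp add: divide_simps)
  ultimately have "inverse (- ln (1 - 1 / t)) \<le> inverse (2 * (1 / t) / (2 - 1 / t))"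
    using le_imp_inverse_le by blast
  also have "\<dots> = t - 1 / 2" using assms by (simp add: field_simps)
  finally show ?thesis by (simp add: frechet_of_pareto_def)
qed

lemma frechet_of_pareto_ge:
  assumes "2 \<le> t" shows "t - 1 / t \<le> frechet_of_pareto t"
proof -
  have le: "- ln (1 - 1 / t) \<le> 2 * (1 / t) / (2 - 1 / t - 2 * (1 / t)\<^sup>2)"
    by (rule neg_ln_one_minus_upper) (use assms in \<open>auto simp: field_simps\<close>)
  have pos: "- ln (1 - 1 / t) > 0" using assms by simp
  have "(t - 1 / t) - 1 / 2 = inverse (2 * (1 / t) / (2 - 1 / t - 2 * (1 / t)\<^sup>2))"
    using assms by (simp add: field_simps power2_eq_square)
  also have "\<dots> \<le> inverse (- ln (1 - 1 / t))"
    using le pos le_imp_inverse_le by blast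
  finally show ?thesis by (simp add: frechet_of_pareto_def)
qed

lemma frechet_of_pareto_mono:
  assumes "1 < s" "s \<le> t" shows "frechet_of_pareto s \<le> frechet_of_pareto t"
proof -
  have a: "ln (1 - 1 / s) \<le> ln (1 - 1 / t)" using assms by (simp add: field_simps)
  have "ln (1 - 1 / t) < 0" using assms by (simp add: field_simps)
  with a show ?thesis unfolding frechet_of_pareto_def
    by (simp add: le_imp_inverse_le)
qed

section \<open>Order statistics of the pseudo-observables\<close>

text \<open>
  Statements about an order statistic become statements about a count of exceedances, for which
  probabilities can be estimated.
\<close>
lemma order_stat_gt_iff:
  assumes "j < n"
  shows "x < order_stat n z (n - j) \<longleftrightarrow> j < card {i \<in> {1..n}. x < z i}"
proof -
  define L where "L = sort (map z [1..<Suc n])"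
  have len: "length L = n" and srt: "sorted L" by (auto simp: L_def)
  have "card {i \<in> {1..n}. x < z i} = length (filter (\<lambda>i. x < z i) [1..<Suc n])"
    by (subst distinct_card[symmetric]) (auto intro!: arg_cong[where f = card])
  also have "\<dots> = length (filter (\<lambda>y. x < y) (map z [1..<Suc n]))"
    by (simp add: filter_map o_def)
  also have "\<dots> = size (filter_mset (\<lambda>y. x < y) (mset (map z [1..<Suc n])))"
    by (metis mset_filter size_mset)
  also have "mset (map z [1..<Suc n]) = mset L" by (simp add: L_def)
  also have "size (filter_mset (\<lambda>y. x < y) (mset L)) = card {i. i < n \<and> x < L ! i}"
    by (metis mset_filter size_mset length_filter_conv_card len)
  finally have card: "card {i \<in> {1..n}. x < z i} = card {i. i < n \<and> x < L ! i}" .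
  have os: "order_stat n z (n - j) = L ! (n - j - 1)" by (simp add: order_stat_def L_def)
  show ?thesis
  proof
    assume "x < order_stat n z (n - j)"
    then have "{n - j - 1..<n} \<subseteq> {i. i < n \<and> x < L ! i}"
      using sorted_nth_mono[OF srt] len unfolding os by (auto intro: less_le_trans)
    then have "card {n - j - 1..<n} \<le> card {i. i < n \<and> x < L ! i}" by (intro card_mono) auto
    then show "j < card {i \<in> {1..n}. x < z i}" using card assms by simp
  next
    assume j: "j < card {i \<in> {1..n}. x < z i}"
    show "x < order_stat n z (n - j)"
    proof (rule ccontr)
      assume neg: "\<not> x < order_stat n z (n - j)"
      have "{i. i < n \<and> x < L ! i} \<subseteq> {n - j..<n}"
      proof clarify
        fix i assume i: "i < n" "x < L ! i"
        have "\<not> i \<le> n - j - 1"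
          using sorted_nth_mono[OF srt, of i "n - j - 1"] len assms neg i unfolding os by auto
        then show "i \<in> {n - j..<n}" using i by auto
      qed
      then have "card {i. i < n \<and> x < L ! i} \<le> card {n - j..<n}" by (intro card_mono) auto
      then show False using card assms j by simp
    qed
  qed
qed

lemma order_stat_mono:
  assumes "1 \<le> i" "i \<le> j" "j \<le> n"
  shows "order_stat n z i \<le> order_stat n z j"
  unfolding order_stat_def using assms by (intro sorted_nth_mono) auto

lemma order_stat_comp_mono:
  assumes mono: "\<And>a b. a \<in> z ` {1..n} \<Longrightarrow> b \<in> z ` {1..n} \<Longrightarrow> a \<le> b \<Longrightarrow> g a \<le> g b"
    and "1 \<le> j" "j \<le> n"
  shows "order_stat n (\<lambda>i. g (z i)) j = g (order_stat n z j)"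
proof -
  define L where "L = sort (map z [1..<Suc n])"
  have set: "set L = z ` {1..n}" by (auto simp: L_def)
  have "sorted (map g L)"
    unfolding sorted_map
    by (rule sorted_wrt_mono_rel[of _ "(\<le>)"]) (auto simp: set L_def intro!: mono)
  moreover have "mset (map g L) = mset (map (\<lambda>i. g (z i)) [1..<Suc n])"
    by (simp add: L_def mset_map multiset.map_comp o_def)
  ultimately have "sort (map (\<lambda>i. g (z i)) [1..<Suc n]) = map g L"
    by (metis properties_for_sort)
  then show ?thesis using assms by (simp add: order_stat_def L_def)
qed

lemma sample_rank_bounds:
  assumes "i \<in> {1..n}"
  shows "1 \<le> sample_rank n x i" "sample_rank n x i \<le> n"
proof -
  have eq: "sample_rank n x i = card {j \<in> {1..n}. x j \<le> x i}"
    unfolding sample_rank_def by (subst sum_of_bool_eq) (auto intro!: arg_cong[where f = card])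
  have "{i} \<subseteq> {j \<in> {1..n}. x j \<le> x i}" using assms by auto
  from card_mono[OF _ this] show "1 \<le> sample_rank n x i" by (simp add: eq)
  have "{j \<in> {1..n}. x j \<le> x i} \<subseteq> {1..n}" by auto
  from card_mono[OF _ this] show "sample_rank n x i \<le> n" by (simp add: eq)
qed

lemma pseudo_T_gt_1:
  assumes "i \<in> {1..n}" shows "1 < pseudo_T n x y i"
  using sample_rank_bounds[OF assms, of x] sample_rank_bounds[OF assms, of y]
  by (auto simp: pseudo_T_def field_simps)

lemma pseudo_Z_eq:
  assumes i: "i \<in> {1..n}"
  shows "pseudo_Z n x y i = frechet_of_pareto (pseudo_T n x y i)"
proof -
  define N where "N = real n + 1"
  define a where "a = real (sample_rank n x i)"
  define b where "b = real (sample_rank n y i)"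
  have *: "frechet_of_pareto (N / (N - a)) = inverse (- ln (a / N)) + 1 / 2"
    if "1 \<le> a" "a \<le> N - 1" for a
    using that by (simp add: frechet_of_pareto_def field_simps)
  have ab: "1 \<le> a" "a \<le> N - 1" "1 \<le> b" "b \<le> N - 1"
    using sample_rank_bounds[OF i, of x] sample_rank_bounds[OF i, of y]
    by (auto simp: a_def b_def N_def)
  show ?thesis
  proof (cases "a \<le> b")
    case True
    then have "N / (N - a) \<le> N / (N - b)" "- ln (b / N) \<le> - ln (a / N)"
      using ab by (auto simp: frac_le divide_right_mono)
    then show ?thesis using *[of a] ab
      by (simp add: pseudo_Z_def pseudo_T_def a_def b_def N_def min_def max_def)
  next
    case False
    then have "N / (N - b) \<le> N / (N - a)" "- ln (a / N) \<le> - ln (b / N)"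
      using ab by (auto simp: frac_le divide_right_mono)
    then show ?thesis using *[of b] ab
      by (simp add: pseudo_Z_def pseudo_T_def a_def b_def N_def min.absorb2 max.absorb2)
  qed
qed

lemma order_stat_pseudo_Z:
  assumes "1 \<le> j" "j \<le> n"
  shows "order_stat n (pseudo_Z n x y) j = frechet_of_pareto (order_stat n (pseudo_T n x y) j)"
proof -
  have "order_stat n (pseudo_Z n x y) j = order_stat n (\<lambda>i. frechet_of_pareto (pseudo_T n x y i)) j"
    unfolding order_stat_def
    by (intro arg_cong2[where f = nth] arg_cong[where f = sort] map_cong) (auto simp: pseudo_Z_eq)
  also have "\<dots> = frechet_of_pareto (order_stat n (pseudo_T n x y) j)"
    by (rule order_stat_comp_mono) (use assms in \<open>auto intro!: frechet_of_pareto_mono pseudo_T_gt_1\<close>)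
  finally show ?thesis .
qed

section \<open>Stability of the estimators\<close>

text \<open>
  Only ratios to the smallest order statistic in use, here \<open>t0\<close>, enter the estimators; on the logarithmic
  scale they change by an amount that is uniform in \<open>t \<ge> t0\<close>.
\<close>
lemma ln_frechet_ratio_bound:
  assumes t0: "2 \<le> t0" and t: "t0 \<le> t"
  shows "\<bar>ln (frechet_of_pareto t / frechet_of_pareto t0) - ln (t / t0)\<bar> \<le> 2 / t0\<^sup>2"
    and "0 < frechet_of_pareto t"
proof -
  have rel: "0 < frechet_of_pareto u \<and> - (2 / t0\<^sup>2) \<le> ln (frechet_of_pareto u) - ln u
       \<and> ln (frechet_of_pareto u) - ln u \<le> 0"
    if u: "t0 \<le> u" for u
  proof -
    define \<delta> where "\<delta> = 1 / t0\<^sup>2"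
    have u2: "2 \<le> u" using u t0 by simp
    have "2\<^sup>2 \<le> t0\<^sup>2" using t0 by (intro power_mono) auto
    then have d: "0 < \<delta>" "\<delta> \<le> 1 / 4" using t0 by (auto simp: \<delta>_def divide_simps)
    have "t0\<^sup>2 \<le> u\<^sup>2" using u t0 by (intro power_mono) auto
    then have "1 / u\<^sup>2 \<le> \<delta>" unfolding \<delta>_def using t0 u by (intro divide_left_mono) auto
    then have "u * (1 - \<delta>) \<le> u * (1 - 1 / u\<^sup>2)" using u2 by (intro mult_left_mono) auto
    also have "\<dots> = u - 1 / u" using u2 by (simp add: field_simps power2_eq_square)
    also have "\<dots> \<le> frechet_of_pareto u" using u2 by (rule frechet_of_pareto_ge)
    finally have ge: "u * (1 - \<delta>) \<le> frechet_of_pareto u" .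
    have le: "frechet_of_pareto u \<le> u" using u2 by (intro frechet_of_pareto_le) auto
    have pos0: "0 < u * (1 - \<delta>)" using u2 d by simp
    with ge have pos: "0 < frechet_of_pareto u" by linarith
    have "ln u + ln (1 - \<delta>) = ln (u * (1 - \<delta>))" using u2 d by (simp add: ln_mult)
    also have "\<dots> \<le> ln (frechet_of_pareto u)" using ge pos0 by simp
    finally have 1: "ln (1 - \<delta>) \<le> ln (frechet_of_pareto u) - ln u" by simp
    have "- \<delta> - 2 * \<delta>\<^sup>2 \<le> ln (1 - \<delta>)" using d by (intro ln_one_minus_pos_lower_bound) auto
    moreover have "2 * \<delta>\<^sup>2 \<le> \<delta>"
      using d mult_right_mono[of "2 * \<delta>" 1 \<delta>] by (simp add: power2_eq_square)
    ultimately have "- (2 * \<delta>) \<le> ln (1 - \<delta>)" by linarith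
    with 1 have "- (2 * \<delta>) \<le> ln (frechet_of_pareto u) - ln u" by linarith
    moreover have "ln (frechet_of_pareto u) - ln u \<le> 0" using le pos by simp
    ultimately show ?thesis using pos by (simp add: \<delta>_def)
  qed
  from rel[OF t] show "0 < frechet_of_pareto t" by simp
  from rel[OF t] rel[of t0] t t0
  show "\<bar>ln (frechet_of_pareto t / frechet_of_pareto t0) - ln (t / t0)\<bar> \<le> 2 / t0\<^sup>2"
    by (simp add: ln_div abs_le_iff)
qed

lemma exp_le_one_plus_double:
  assumes "0 \<le> d" "d \<le> (1::real)" shows "exp d - 1 \<le> 2 * d"
proof -
  have "exp d \<le> 1 + d + d\<^sup>2" using assms by (rule exp_bound)
  moreover have "d\<^sup>2 \<le> d" using assms mult_left_mono[of d 1 d] by (simp add: power2_eq_square)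
  ultimately show ?thesis by linarith
qed

text \<open>
  A uniform perturbation of the logarithms by \<open>\<delta>\<close> changes every power, and hence the mean, by a
  factor between \<open>exp (- \<bar>a\<bar> \<delta>)\<close> and \<open>exp (\<bar>a\<bar> \<delta>)\<close>.  Because the error is multiplicative, no moment of the
  \<open>\<rho> i\<close> has to be controlled: a lower bound \<open>L\<close> on the mean suffices.
\<close>
lemma inverse_mean_powr_perturb:
  fixes \<rho> \<zeta> :: "nat \<Rightarrow> real"
  assumes m: "0 < m"
    and pos: "\<And>i. i < m \<Longrightarrow> 0 < \<rho> i \<and> 0 < \<zeta> i"
    and near: "\<And>i. i < m \<Longrightarrow> \<bar>ln (\<zeta> i) - ln (\<rho> i)\<bar> \<le> \<delta>"
    and small: "\<bar>a\<bar> * \<delta> \<le> 1"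
    and low: "0 < L" "L \<le> (1 / real m) * (\<Sum>i<m. \<rho> i powr a)"
  shows "\<bar>inverse ((1 / real m) * (\<Sum>i<m. \<zeta> i powr a)) - inverse ((1 / real m) * (\<Sum>i<m. \<rho> i powr a))\<bar>
    \<le> 2 * \<bar>a\<bar> * \<delta> / L"
proof -
  define A where "A = (1 / real m) * (\<Sum>i<m. \<rho> i powr a)"
  define A' where "A' = (1 / real m) * (\<Sum>i<m. \<zeta> i powr a)"
  define d where "d = \<bar>a\<bar> * \<delta>"
  have "0 \<le> \<delta>" using near[OF m] by linarith
  then have d: "0 \<le> d" "d \<le> 1" using small by (auto simp: d_def)
  have tm: "exp (- d) * \<rho> i powr a \<le> \<zeta> i powr a \<and> \<zeta> i powr a \<le> exp d * \<rho> i powr a" if i: "i < m" for i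
  proof -
    have "\<bar>a * ln (\<zeta> i) - a * ln (\<rho> i)\<bar> = \<bar>a\<bar> * \<bar>ln (\<zeta> i) - ln (\<rho> i)\<bar>"
      by (simp add: abs_mult right_diff_distrib flip: abs_mult)
    also have "\<dots> \<le> d" unfolding d_def using near[OF i] by (intro mult_left_mono) auto
    finally show ?thesis using pos[OF i]
      by (simp add: powr_def abs_le_iff flip: exp_add)
  qed
  have lo: "exp (- d) * A \<le> A'"
    unfolding A_def A'_def using tm
    by (auto simp: sum_distrib_left intro!: sum_mono divide_right_mono simp del: exp_minus)
  have hi: "A' \<le> exp d * A"
    unfolding A_def A'_def using tm
    by (auto simp: sum_distrib_left intro!: sum_mono divide_right_mono)
  have A: "L \<le> A" "0 < A" using low by (auto simp: A_def)
  then have A': "0 < A'" using lo less_le_trans[of 0 "exp (- d) * A" A'] by simp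
  have "inverse A' \<le> inverse (exp (- d) * A)"
    using lo A by (intro le_imp_inverse_le) auto
  then have 1: "inverse A' \<le> exp d * inverse A" by (simp add: exp_minus)
  have "inverse (exp d * A) \<le> inverse A'"
    using hi A' by (intro le_imp_inverse_le) auto
  then have 2: "exp (- d) * inverse A \<le> inverse A'" by (simp add: exp_minus)
  have iA: "0 < inverse A" "inverse A \<le> inverse L" using A low by (auto intro: le_imp_inverse_le)
  have "inverse A' - inverse A \<le> (exp d - 1) * inverse A" using 1 by (simp add: algebra_simps)
  also have "\<dots> \<le> 2 * d * inverse L"
    using exp_le_one_plus_double[OF d] iA d by (intro mult_mono) auto
  finally have u: "inverse A' - inverse A \<le> 2 * d * inverse L" .
  have "inverse A - inverse A' \<le> (1 - exp (- d)) * inverse A" using 2 by (simp add: algebra_simps)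
  also have "\<dots> \<le> 2 * d * inverse L"
    using exp_ge_add_one_self[of "- d"] iA d by (intro mult_mono) auto
  finally have l: "inverse A - inverse A' \<le> 2 * d * inverse L" .
  from u l show ?thesis unfolding A_def[symmetric] A'_def[symmetric] by (simp add: d_def abs_le_iff divide_inverse mult.assoc)
qed

text \<open>
  For \<open>q < 1\<close> the exponent \<open>1 - 1/q\<close> is negative and the mean could be close to \<open>0\<close>.  The upper half of
  the indices \<open>i < m\<close>, where the ratios are at most \<open>C\<close>, keeps it above \<open>C powr (- \<bar>1 - 1/q\<bar>) / 2\<close>.  The
  factor \<open>\<bar>1 - 1/q\<bar>\<close> that the perturbation of the mean produces is cancelled by the denominator of the estimator,
  which gives the same bound for all \<open>q\<close>, including the Hill estimator.
\<close>
lemma eta_estimator_perturb: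
  fixes z t :: "nat \<Rightarrow> real"
  assumes m: "0 < m" and q: "0 < q"
    and pos: "\<And>i. i \<le> m \<Longrightarrow> 0 < order_stat n t (n - i) \<and> 0 < order_stat n z (n - i)"
    and near: "\<And>i. i < m \<Longrightarrow> \<bar>ln (order_stat n z (n - i) / order_stat n z (n - m))
       - ln (order_stat n t (n - i) / order_stat n t (n - m))\<bar> \<le> \<delta>"
    and incr: "\<And>i. i < m \<Longrightarrow> order_stat n t (n - m) \<le> order_stat n t (n - i)"
    and ratio: "\<And>i. m div 2 \<le> i \<Longrightarrow> i < m \<Longrightarrow> order_stat n t (n - i) \<le> C * order_stat n t (n - m)"
    and C: "1 \<le> C" and small: "\<bar>1 - 1 / q\<bar> * \<delta> \<le> 1"
  shows "\<bar>eta_estimator q n m z - eta_estimator q n m t\<bar> \<le> 4 * C powr \<bar>1 - 1 / q\<bar> * \<delta>"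
proof -
  define \<rho> where "\<rho> = (\<lambda>i. order_stat n t (n - i) / order_stat n t (n - m))"
  define \<zeta> where "\<zeta> = (\<lambda>i. order_stat n z (n - i) / order_stat n z (n - m))"
  define a where "a = 1 - 1 / q"
  have rz: "0 < \<rho> i \<and> 0 < \<zeta> i" if "i < m" for i
    using pos[of i] pos[of m] that by (auto simp: \<rho>_def \<zeta>_def)
  have nr: "\<bar>ln (\<zeta> i) - ln (\<rho> i)\<bar> \<le> \<delta>" if "i < m" for i
    using near[OF that] by (simp add: \<rho>_def \<zeta>_def)
  have d0: "0 \<le> \<delta>" using nr[OF m] by linarith
  have C1: "1 \<le> C powr \<bar>a\<bar>" using C by (simp add: ge_one_powr_ge_zero)
  show ?thesis
  proof (cases "q = 1")
    case True
    have "\<bar>eta_estimator q n m z - eta_estimator q n m t\<bar>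
        = (1 / real m) * \<bar>\<Sum>i<m. ln (\<zeta> i) - ln (\<rho> i)\<bar>"
      using True by (simp add: eta_estimator_def \<rho>_def \<zeta>_def sum_subtractf diff_divide_distrib[symmetric])
    also have "\<dots> \<le> (1 / real m) * (\<Sum>i<m. \<delta>)"
      by (intro mult_left_mono order_trans[OF sum_abs] sum_mono) (auto simp: nr)
    also have "\<dots> = 1 * \<delta>" using m by simp
    also have "\<dots> \<le> (4 * C powr \<bar>a\<bar>) * \<delta>" using C1 d0 by (intro mult_right_mono) auto
    finally show ?thesis by (simp add: a_def)
  next
    case False
    then have a0: "a \<noteq> 0" using q by (simp add: a_def)
    define L where "L = 1 / 2 * C powr (- \<bar>a\<bar>)"
    have L0: "0 < L" using C by (simp add: L_def)
    have tm: "C powr (- \<bar>a\<bar>) \<le> \<rho> i powr a" if "m div 2 \<le> i" "i < m" for i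
    proof -
      have "1 \<le> \<rho> i" "\<rho> i \<le> C"
        using incr[of i] ratio[of i] pos[of m] that by (auto simp: \<rho>_def field_simps)
      then show ?thesis
      proof (cases "0 \<le> a")
        case True
        then have "1 \<le> \<rho> i powr a" using \<open>1 \<le> \<rho> i\<close> by (simp add: ge_one_powr_ge_zero)
        moreover have "C powr (- \<bar>a\<bar>) \<le> 1" using C powr_mono[of "- \<bar>a\<bar>" 0 C] by simp
        ultimately show ?thesis by linarith
      next
        case False
        then show ?thesis using powr_mono2'[of a "\<rho> i" C] \<open>1 \<le> \<rho> i\<close> \<open>\<rho> i \<le> C\<close> by simp
      qed
    qed
    have "real m * L \<le> real (m - m div 2) * C powr (- \<bar>a\<bar>)"
    proof -
      have "real m / 2 \<le> real (m - m div 2)" by linarith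
      then have "real m / 2 * C powr (- \<bar>a\<bar>) \<le> real (m - m div 2) * C powr (- \<bar>a\<bar>)"
        by (rule mult_right_mono) simp
      then show ?thesis by (simp add: L_def)
    qed
    also have "\<dots> = (\<Sum>i\<in>{m div 2..<m}. C powr (- \<bar>a\<bar>))" by simp
    also have "\<dots> \<le> (\<Sum>i\<in>{m div 2..<m}. \<rho> i powr a)" using tm by (intro sum_mono) auto
    also have "\<dots> \<le> (\<Sum>i<m. \<rho> i powr a)" by (intro sum_mono2) auto
    finally have L: "L \<le> (1 / real m) * (\<Sum>i<m. \<rho> i powr a)" using m by (simp add: field_simps)
    have "\<bar>inverse ((1 / real m) * (\<Sum>i<m. \<zeta> i powr a)) - inverse ((1 / real m) * (\<Sum>i<m. \<rho> i powr a))\<bar>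
      \<le> 2 * \<bar>a\<bar> * \<delta> / L"
      by (rule inverse_mean_powr_perturb) (use m rz nr small L0 L in \<open>auto simp: a_def\<close>)
    then have "\<bar>inverse ((1 / real m) * (\<Sum>i<m. \<zeta> i powr a)) - inverse ((1 / real m) * (\<Sum>i<m. \<rho> i powr a))\<bar> / \<bar>a\<bar>
      \<le> 2 * \<bar>a\<bar> * \<delta> / L / \<bar>a\<bar>"
      by (rule divide_right_mono) simp
    also have "2 * \<bar>a\<bar> * \<delta> / L / \<bar>a\<bar> = 4 * C powr \<bar>a\<bar> * \<delta>"
      using a0 by (simp add: L_def powr_minus field_simps)
    finally have "\<bar>(inverse ((1 / real m) * (\<Sum>i<m. \<zeta> i powr a)) - inverse ((1 / real m) * (\<Sum>i<m. \<rho> i powr a))) / a\<bar>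
      \<le> 4 * C powr \<bar>a\<bar> * \<delta>" by simp
    moreover have "eta_estimator q n m z - eta_estimator q n m t
      = - ((inverse ((1 / real m) * (\<Sum>i<m. \<zeta> i powr a)) - inverse ((1 / real m) * (\<Sum>i<m. \<rho> i powr a))) / a)"
      using False unfolding eta_estimator_def \<rho>_def[symmetric] \<zeta>_def[symmetric] a_def[symmetric]
      by (simp add: \<rho>_def \<zeta>_def diff_divide_distrib)
    ultimately show ?thesis by (simp add: a_def)
  qed
qed

text \<open>
  The number \<open>128\<close> arises twice: as \<open>16 * 8\<close>, the bound on the ratios between the two located order statistics, and
  from the logarithmic error \<open>2 / (s / 8)\<^sup>2 = 128 / s\<^sup>2\<close>.
\<close>
lemma estimator_difference_bound:
  assumes m: "0 < m" "m < n" and q: "0 < q"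
    and lo: "s / 8 < order_stat n (pseudo_T n x y) (n - m)"
    and hi: "order_stat n (pseudo_T n x y) (n - m div 2) \<le> 16 * s"
    and s: "16 \<le> s" and small: "\<bar>1 - 1 / q\<bar> * (128 / s\<^sup>2) \<le> 1"
  shows "\<bar>eta_estimator q n m (pseudo_Z n x y) - eta_estimator q n m (pseudo_T n x y)\<bar>
    \<le> 4 * 128 powr \<bar>1 - 1 / q\<bar> * (128 / s\<^sup>2)"
proof -
  define T where "T = (\<lambda>i. order_stat n (pseudo_T n x y) (n - i))"
  have incr: "T j \<le> T i" if "i \<le> j" "j \<le> m" for i j
    unfolding T_def using that m by (intro order_stat_mono) auto
  have Z: "order_stat n (pseudo_Z n x y) (n - i) = frechet_of_pareto (T i)" if "i \<le> m" for i
    unfolding T_def using that m by (intro order_stat_pseudo_Z) auto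
  have Tm: "2 \<le> T m" "s / 8 \<le> T m" using lo s by (auto simp: T_def)
  have "(s / 8)\<^sup>2 \<le> (T m)\<^sup>2" using Tm s by (intro power_mono) auto
  then have "2 / (T m)\<^sup>2 \<le> 2 / (s / 8)\<^sup>2" using s Tm by (intro divide_left_mono) auto
  then have dl: "2 / (T m)\<^sup>2 \<le> 128 / s\<^sup>2" by (simp add: power2_eq_square field_simps)
  show ?thesis
  proof (rule eta_estimator_perturb)
    fix i assume i: "i \<le> m"
    have "T m \<le> T i" using i by (intro incr) auto
    then show "0 < order_stat n (pseudo_T n x y) (n - i) \<and> 0 < order_stat n (pseudo_Z n x y) (n - i)"
      using ln_frechet_ratio_bound(2)[OF Tm(1), of "T i"] Tm i by (auto simp: Z T_def)
  next
    fix i assume i: "i < m"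
    have "T m \<le> T i" using i by (intro incr) auto
    from ln_frechet_ratio_bound(1)[OF Tm(1) this] dl i
    show "\<bar>ln (order_stat n (pseudo_Z n x y) (n - i) / order_stat n (pseudo_Z n x y) (n - m))
       - ln (order_stat n (pseudo_T n x y) (n - i) / order_stat n (pseudo_T n x y) (n - m))\<bar> \<le> 128 / s\<^sup>2"
      by (auto simp: Z T_def)
    show "order_stat n (pseudo_T n x y) (n - m) \<le> order_stat n (pseudo_T n x y) (n - i)"
      using \<open>T m \<le> T i\<close> by (simp add: T_def)
  next
    fix i assume i: "m div 2 \<le> i" "i < m"
    have "T i \<le> T (m div 2)" using i by (intro incr) auto
    also have "\<dots> \<le> 128 * (s / 8)" using hi by (simp add: T_def)
    also have "\<dots> \<le> 128 * T m" using Tm by simp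
    finally show "order_stat n (pseudo_T n x y) (n - i) \<le> 128 * order_stat n (pseudo_T n x y) (n - m)"
      by (simp add: T_def)
  qed (use m q small in auto)
qed

section \<open>A lower bound for regularly varying functions\<close>

text \<open>
  Boundedness part of the uniform convergence theorem for regular variation, in additive form.  If
  the increments were unbounded along \<open>x n\<close> and \<open>u n\<close>, consider the \<open>y\<close> for which all late increments of
  \<open>f\<close> from \<open>x n\<close> to \<open>x n + y\<close> are bounded, and likewise the \<open>y\<close> for the base points \<open>x n + u n\<close>.  By
  continuity of measure each set has measure above \<open>3/2\<close> within an interval of length \<open>2\<close>.  After translation by
  \<open>u n\<close> both lie in \<open>{0..3}\<close>, so they meet; a common point links \<open>f (x n)\<close> to \<open>f (x n + u n)\<close> by two
  bounded increments.  Measurability is what makes this work: without it regular variation does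
  not imply any bound on compact sets.
\<close>
lemma asymptotically_additive_bounded:
  fixes f :: "real \<Rightarrow> real"
  assumes f: "f \<in> borel_measurable borel"
    and lim: "\<And>u. ((\<lambda>x. f (x + u) - f x) \<longlongrightarrow> \<rho> * u) at_top"
  shows "\<exists>X C. \<forall>x\<ge>X. \<forall>u\<in>{0..1}. \<bar>f (x + u) - f x\<bar> \<le> C"
proof (rule ccontr)
  assume neg: "\<not> ?thesis"
  have "\<forall>n. \<exists>x u. real n \<le> x \<and> u \<in> {0..1} \<and> real n < \<bar>f (x + u) - f x\<bar>"
  proof
    fix n
    have "\<not> (\<forall>x\<ge>real n. \<forall>u\<in>{0..1}. \<bar>f (x + u) - f x\<bar> \<le> real n)" using neg by blast
    then show "\<exists>x u. real n \<le> x \<and> u \<in> {0..1} \<and> real n < \<bar>f (x + u) - f x\<bar>"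
      unfolding not_all not_le Ball_def not_imp by blast
  qed
  then obtain x u where xu: "\<And>n. real n \<le> x n \<and> u n \<in> {0..1} \<and> real n < \<bar>f (x n + u n) - f (x n)\<bar>"
    unfolding choice_iff by blast
  have u01: "0 \<le> u n" "u n \<le> 1" for n using xu[of n] by auto
  have x_top: "filterlim x at_top sequentially"
    by (rule filterlim_at_top_mono[OF filterlim_real_sequentially always_eventually]) (use xu in blast)
  have xu_top: "filterlim (\<lambda>n. x n + u n) at_top sequentially"
  proof (rule filterlim_at_top_mono[OF x_top])
    show "\<forall>\<^sub>F n in sequentially. x n \<le> x n + u n" by (simp add: u01)
  qed
  \<comment> \<open>a bound that eventually holds for every single increment of length at most 2\<close>
  define D where "D = \<bar>\<rho>\<bar> * 2 + 1"
  have mass: "\<exists>N. 3 / 2 < measure lborel {y \<in> {0..2}. \<forall>n\<ge>N. \<bar>f (w n + y) - f (w n)\<bar> \<le> D}"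
    if w: "filterlim w at_top sequentially" for w :: "nat \<Rightarrow> real"
  proof -
    define A where "A = (\<lambda>N::nat. {y \<in> {0..2::real}. \<forall>n\<ge>N. \<bar>f (w n + y) - f (w n)\<bar> \<le> D})"
    have [measurable]: "f \<in> borel_measurable borel" by (rule f)
    have mA: "A N \<in> sets lborel" for N
      unfolding A_def by measurable
    have un: "(\<Union>N. A N) = {0..2}"
    proof
      show "(\<Union>N. A N) \<subseteq> {0..2}" by (auto simp: A_def)
      show "{0..2} \<subseteq> (\<Union>N. A N)"
      proof
        fix y :: real assume y: "y \<in> {0..2}"
        have "(\<lambda>n. f (w n + y) - f (w n)) \<longlonglongrightarrow> \<rho> * y"
          using filterlim_compose[OF lim w] .
        then have "\<forall>\<^sub>F n in sequentially. dist (f (w n + y) - f (w n)) (\<rho> * y) < 1"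
          by (rule tendstoD) simp
        then obtain N where N: "\<And>n. n \<ge> N \<Longrightarrow> \<bar>f (w n + y) - f (w n) - \<rho> * y\<bar> < 1"
          by (auto simp: eventually_sequentially dist_real_def)
        have "\<bar>\<rho> * y\<bar> \<le> \<bar>\<rho>\<bar> * 2" using y by (auto simp: abs_mult intro!: mult_left_mono)
        then have "\<bar>f (w n + y) - f (w n)\<bar> \<le> D" if "n \<ge> N" for n
          using N[OF that] by (simp add: D_def abs_le_iff abs_less_iff)
        then show "y \<in> (\<Union>N. A N)" using y by (auto simp: A_def)
      qed
    qed
    have "(\<lambda>N. measure lborel (A N)) \<longlonglongrightarrow> measure lborel (\<Union>N. A N)"
    proof (rule Lim_measure_incseq)
      show "range A \<subseteq> sets lborel" using mA by auto
      show "incseq A" unfolding incseq_def A_def by (auto intro: order_trans)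
      show "emeasure lborel (\<Union>N. A N) \<noteq> \<infinity>" unfolding un by simp
    qed
    then have "(\<lambda>N. measure lborel (A N)) \<longlonglongrightarrow> 2" by (simp add: un)
    then have "\<forall>\<^sub>F N in sequentially. 3 / 2 < measure lborel (A N)"
      by (rule order_tendstoD) simp
    then show ?thesis unfolding A_def by (rule eventually_happens'[OF sequentially_bot])
  qed
  from mass[OF x_top] obtain N1 where
    N1: "3 / 2 < measure lborel {y \<in> {0..2}. \<forall>n\<ge>N1. \<bar>f (x n + y) - f (x n)\<bar> \<le> D}" by blast
  from mass[OF xu_top] obtain N2 where
    N2: "3 / 2 < measure lborel {y \<in> {0..2}. \<forall>n\<ge>N2. \<bar>f (x n + u n + y) - f (x n + u n)\<bar> \<le> D}" by blast
  define n where "n = max (max N1 N2) (nat \<lceil>2 * D\<rceil>)"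
  define A where "A = {y \<in> {0..2}. \<bar>f (x n + y) - f (x n)\<bar> \<le> D}"
  define B where "B = {y. y - u n \<in> {0..2} \<and> \<bar>f (x n + u n + (y - u n)) - f (x n + u n)\<bar> \<le> D}"
  define B0 where "B0 = {y \<in> {0..2}. \<bar>f (x n + u n + y) - f (x n + u n)\<bar> \<le> D}"
  have [measurable]: "f \<in> borel_measurable borel" by (rule f)
  have mA: "A \<in> sets borel" and mB: "B \<in> sets borel" and mB0: "B0 \<in> sets borel"
    unfolding A_def B_def B0_def by measurable
  have sub3: "A \<subseteq> {0..3}" "B \<subseteq> {0..3}" "B0 \<subseteq> {0..2}"
    using u01[of n] by (auto simp: A_def B_def B0_def)
  have fin: "C \<in> fmeasurable lborel" if "C \<subseteq> {0..3}" "C \<in> sets borel" for C :: "real set"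
  proof (rule fmeasurableI2[of "{0..3}"])
    show "{0..3::real} \<in> fmeasurable lborel" by (simp add: fmeasurable_def)
  qed (use that in auto)
  have fA: "A \<in> fmeasurable lborel" "B \<in> fmeasurable lborel" "B0 \<in> fmeasurable lborel"
    using sub3 mA mB mB0 by (auto intro!: fin)
  have "3 / 2 < measure lborel A"
  proof (rule less_le_trans[OF N1], rule measure_mono_fmeasurable)
    show "{y \<in> {0..2}. \<forall>n\<ge>N1. \<bar>f (x n + y) - f (x n)\<bar> \<le> D} \<subseteq> A"
      by (auto simp: A_def n_def)
    show "{y \<in> {0..2}. \<forall>n\<ge>N1. \<bar>f (x n + y) - f (x n)\<bar> \<le> D} \<in> sets lborel" by measurable
  qed (rule fA)
  moreover have "3 / 2 < measure lborel B"
  proof -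
    have "3 / 2 < measure lborel B0"
    proof (rule less_le_trans[OF N2], rule measure_mono_fmeasurable)
      show "{y \<in> {0..2}. \<forall>n\<ge>N2. \<bar>f (x n + u n + y) - f (x n + u n)\<bar> \<le> D} \<subseteq> B0"
        by (auto simp: B0_def n_def)
      show "{y \<in> {0..2}. \<forall>n\<ge>N2. \<bar>f (x n + u n + y) - f (x n + u n)\<bar> \<le> D} \<in> sets lborel"
        by measurable
    qed (rule fA)
    also have "measure lborel B0 = measure (distr lborel borel ((+) (- u n))) B0"
      by (simp add: lborel_distr_plus)
    also have "\<dots> = measure lborel ((+) (- u n) -` B0 \<inter> space lborel)"
      by (rule measure_distr) (use mB0 in auto)
    also have "(+) (- u n) -` B0 \<inter> space lborel = B"
      by (auto simp: B0_def B_def algebra_simps)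
    finally show ?thesis .
  qed
  \<comment> \<open>total measure above 3 inside an interval of length 3\<close>
  moreover have "A \<inter> B \<noteq> {}"
  proof
    assume disj: "A \<inter> B = {}"
    have "measure lborel A + measure lborel B = measure lborel (A \<union> B)"
      by (rule measure_Un_AE[symmetric, OF _ fA(1,2)]) (use disj in auto)
    also have "\<dots> \<le> measure lborel {0..3::real}"
      by (rule measure_mono_fmeasurable) (use sub3 mA mB in \<open>auto intro!: fin\<close>)
    finally show False using \<open>3 / 2 < measure lborel B\<close> \<open>3 / 2 < measure lborel A\<close> by simp
  qed
  ultimately obtain y where "y \<in> A" "y \<in> B" by blast
  then have "\<bar>f (x n + y) - f (x n)\<bar> \<le> D" "\<bar>f (x n + y) - f (x n + u n)\<bar> \<le> D"
    by (auto simp: A_def B_def)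
  then have "\<bar>f (x n + u n) - f (x n)\<bar> \<le> 2 * D" by linarith
  moreover have "2 * D \<le> real (nat \<lceil>2 * D\<rceil>)" by (rule real_nat_ceiling_ge)
  then have "2 * D \<le> real n" by (simp add: n_def)
  ultimately show False using xu[of n] by linarith
qed

text \<open>
  Unit steps eventually increase \<open>f\<close> by at least \<open>\<rho> - \<epsilon>\<close>, which gives the bound on a lattice; the previous
  lemma fills in the points between two lattice points at the cost of a constant.
\<close>
lemma asymptotically_additive_lower_bound:
  fixes f :: "real \<Rightarrow> real"
  assumes f: "f \<in> borel_measurable borel"
    and lim: "\<And>u. ((\<lambda>x. f (x + u) - f x) \<longlongrightarrow> \<rho> * u) at_top"
    and e: "0 < \<epsilon>"
  shows "\<exists>c. \<forall>\<^sub>F x in at_top. c + (\<rho> - \<epsilon>) * x \<le> f x"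
proof -
  obtain X C where XC: "\<And>x u. X \<le> x \<Longrightarrow> u \<in> {0..1} \<Longrightarrow> \<bar>f (x + u) - f x\<bar> \<le> C"
    using asymptotically_additive_bounded[OF f lim] by blast
  have "\<forall>\<^sub>F x in at_top. \<rho> - \<epsilon> < f (x + 1) - f x"
    using lim[of 1] e by (intro order_tendstoD(1)[where y = \<rho>]) auto
  then obtain X' where X': "\<And>x. X' \<le> x \<Longrightarrow> \<rho> - \<epsilon> < f (x + 1) - f x"
    by (auto simp: eventually_at_top_linorder)
  define Y where "Y = max X X'"
  have lattice: "f Y + (\<rho> - \<epsilon>) * real j \<le> f (Y + real j)" for j
  proof (induction j)
    case (Suc j)
    have "\<rho> - \<epsilon> < f (Y + real j + 1) - f (Y + real j)"
      by (rule X') (simp add: Y_def)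
    then show ?case using Suc by (simp add: algebra_simps)
  qed simp
  have "f Y - C - \<bar>\<rho> - \<epsilon>\<bar> - (\<rho> - \<epsilon>) * Y + (\<rho> - \<epsilon>) * x \<le> f x" if x: "Y \<le> x" for x
  proof -
    define j where "j = nat \<lfloor>x - Y\<rfloor>"
    define u where "u = x - Y - real j"
    have "real j = real_of_int \<lfloor>x - Y\<rfloor>" using x by (simp add: j_def)
    then have u: "u \<in> {0..1}" unfolding u_def atLeastAtMost_iff by linarith
    have x_eq: "x = Y + real j + u" by (simp add: u_def)
    have "\<bar>f (Y + real j + u) - f (Y + real j)\<bar> \<le> C" by (rule XC[OF _ u]) (simp add: Y_def)
    moreover have "(\<rho> - \<epsilon>) * u \<le> \<bar>\<rho> - \<epsilon>\<bar>"
    proof -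
      have "(\<rho> - \<epsilon>) * u \<le> \<bar>\<rho> - \<epsilon>\<bar> * u" using u by (intro mult_right_mono) auto
      also have "\<dots> \<le> \<bar>\<rho> - \<epsilon>\<bar>" using u by (intro mult_left_le) auto
      finally show ?thesis .
    qed
    ultimately show ?thesis using lattice[of j] by (simp add: x_eq algebra_simps)
  qed
  then show ?thesis unfolding eventually_at_top_linorder by blast
qed

text \<open>
  The lower one of Potter's bounds with one argument fixed, by passing to \<open>x \<mapsto> ln (g (exp x))\<close>.
\<close>
lemma regularly_varying_lower_bound:
  fixes g :: "real \<Rightarrow> real"
  assumes meas: "(\<lambda>x. g (exp x)) \<in> borel_measurable borel"
    and pos: "\<forall>\<^sub>F t in at_top. 0 < g t"
    and rv: "regularly_varying g \<rho>"
    and e: "0 < \<epsilon>"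
  shows "\<exists>c>0. \<forall>\<^sub>F t in at_top. c * t powr (\<rho> - \<epsilon>) \<le> g t"
proof -
  define f where "f = (\<lambda>x. ln (g (exp x)))"
  have f: "f \<in> borel_measurable borel" unfolding f_def using meas by measurable
  have posx: "\<forall>\<^sub>F x in at_top. 0 < g (exp x)"
    by (rule eventually_compose_filterlim[OF pos exp_at_top])
  have "((\<lambda>x. f (x + u) - f x) \<longlongrightarrow> \<rho> * u) at_top" for u
  proof -
    have "((\<lambda>t. g (t * exp u) / g t) \<longlongrightarrow> exp u powr \<rho>) at_top"
      using rv unfolding regularly_varying_def by simp
    then have "((\<lambda>x. g (exp x * exp u) / g (exp x)) \<longlongrightarrow> exp u powr \<rho>) at_top"
      by (rule filterlim_compose[OF _ exp_at_top])
    then have "((\<lambda>x. ln (g (exp x * exp u) / g (exp x))) \<longlongrightarrow> ln (exp u powr \<rho>)) at_top"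
      by (intro tendsto_ln) auto
    moreover have "\<forall>\<^sub>F x in at_top. ln (g (exp x * exp u) / g (exp x)) = f (x + u) - f x"
    proof -
      have "filterlim (\<lambda>x::real. x + u) at_top at_top"
        by (intro filterlim_at_top_mono[OF filterlim_tendsto_add_at_top[OF tendsto_const[of u] filterlim_ident]])
           (auto simp: add.commute)
      then have "\<forall>\<^sub>F x in at_top. 0 < g (exp (x + u))"
        by (rule eventually_compose_filterlim[OF posx])
      with posx show ?thesis
        by eventually_elim (simp add: f_def ln_div exp_add)
    qed
    ultimately have "((\<lambda>x. f (x + u) - f x) \<longlongrightarrow> ln (exp u powr \<rho>)) at_top"
      by (rule Lim_transform_eventually)
    then show ?thesis by (simp add: ln_powr)
  qed
  from asymptotically_additive_lower_bound[OF f this e] obtain c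
    where c: "\<forall>\<^sub>F x in at_top. c + (\<rho> - \<epsilon>) * x \<le> f x" by blast
  have "\<forall>\<^sub>F t in at_top. c + (\<rho> - \<epsilon>) * ln t \<le> f (ln t)"
    by (rule eventually_compose_filterlim[OF c ln_at_top])
  then have "\<forall>\<^sub>F t in at_top. exp c * t powr (\<rho> - \<epsilon>) \<le> g t"
    using pos eventually_gt_at_top[of "0::real"]
  proof eventually_elim
    case (elim t)
    then have "c + (\<rho> - \<epsilon>) * ln t \<le> ln (g t)" by (simp add: f_def)
    then have "exp (c + (\<rho> - \<epsilon>) * ln t) \<le> exp (ln (g t))" by (rule iffD2[OF exp_le_cancel_iff])
    then show ?case using elim by (simp add: powr_def exp_add)
  qed
  then show ?thesis by (intro exI[of _ "exp c"]) auto
qed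

section \<open>Concentration of counts\<close>

text \<open>
  Pairwise independence gives the binomial variance bound \<open>card I * p\<close>.  Proportionality to \<open>p\<close> is
  essential below, where \<open>p\<close> tends to \<open>0\<close> with the sample size.
\<close>
lemma (in prob_space) count_Chebyshev:
  fixes A :: "'i \<Rightarrow> 'a set"
  assumes fin: "finite I"
    and A: "\<And>i. i \<in> I \<Longrightarrow> A i \<in> events"
    and p: "\<And>i. i \<in> I \<Longrightarrow> prob (A i) = p"
    and indep: "\<And>i j. i \<in> I \<Longrightarrow> j \<in> I \<Longrightarrow> i \<noteq> j \<Longrightarrow> prob (A i \<inter> A j) = p * p"
    and a: "0 < a"
  shows "prob {\<omega> \<in> space M. a \<le> \<bar>(\<Sum>i\<in>I. indicator (A i) \<omega>) - real (card I) * p\<bar>} \<le> real (card I) * p / a\<^sup>2"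
proof -
  define S where "S = (\<lambda>\<omega>. \<Sum>i\<in>I. indicator (A i) \<omega> :: real)"
  have [measurable]: "S \<in> borel_measurable M" unfolding S_def using A by measurable
  have int: "integrable M (\<lambda>\<omega>. indicator (A i \<inter> A j) \<omega> :: real)" if "i \<in> I" "j \<in> I" for i j
    using that A by (intro integrable_real_indicator) (auto simp: emeasure_eq_measure)
  have ES: "expectation S = real (card I) * p"
    using int[of i i for i] A p unfolding S_def by (subst Bochner_Integration.integral_sum) auto
  have S2: "(S \<omega>)\<^sup>2 = (\<Sum>i\<in>I. \<Sum>j\<in>I. indicator (A i \<inter> A j) \<omega>)" for \<omega>
    unfolding S_def power2_eq_square sum_product by (simp add: indicator_inter_arith)
  have int2: "integrable M (\<lambda>\<omega>. (S \<omega>)\<^sup>2)"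
    unfolding S2 using int by (intro Bochner_Integration.integrable_sum) auto
  have "expectation (\<lambda>\<omega>. (S \<omega>)\<^sup>2) = (\<Sum>i\<in>I. \<Sum>j\<in>I. prob (A i \<inter> A j))"
    unfolding S2 using int A by (subst Bochner_Integration.integral_sum)
      (auto intro!: sum.cong Bochner_Integration.integrable_sum simp: Bochner_Integration.integral_sum)
  also have "\<dots> \<le> (\<Sum>i\<in>I. \<Sum>j\<in>I. (if i = j then p else 0) + p * p)"
    by (intro sum_mono) (auto simp: p indep)
  also have "\<dots> = real (card I) * p + (real (card I) * p)\<^sup>2"
    using fin by (simp add: sum.distrib power2_eq_square algebra_simps)
  finally have E2: "expectation (\<lambda>\<omega>. (S \<omega>)\<^sup>2) \<le> real (card I) * p + (real (card I) * p)\<^sup>2" .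
  have "integrable M S"
    unfolding S_def using int[of i i for i] by (intro Bochner_Integration.integrable_sum) auto
  then have "variance S = expectation (\<lambda>\<omega>. (S \<omega>)\<^sup>2) - (real (card I) * p)\<^sup>2"
    using int2 by (subst variance_eq) (simp_all add: ES)
  with E2 have "variance S \<le> real (card I) * p" by linarith
  moreover have "prob {\<omega> \<in> space M. a \<le> \<bar>S \<omega> - expectation S\<bar>} \<le> variance S / a\<^sup>2"
    by (rule Chebyshev_inequality) (use int2 a in auto)
  ultimately show ?thesis
    unfolding ES unfolding S_def by (meson divide_right_mono order_trans zero_le_power2)
qed

text \<open>
  The sets \<open>D n\<close> may shrink with \<open>n\<close>, as long as the expected number of points in them tends to infinity.
\<close>
lemma (in prob_space) count_concentration:
  fixes W :: "nat \<Rightarrow> 'a \<Rightarrow> 'b :: topological_space"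
  assumes indep: "indep_vars (\<lambda>i. borel) W {1..}"
    and law: "\<And>i. i \<ge> 1 \<Longrightarrow> distr M borel (W i) = \<mu>"
    and D: "\<And>n. D n \<in> sets borel"
    and large: "filterlim (\<lambda>n. real n * measure \<mu> (D n)) at_top sequentially"
  shows "\<exists>G. (\<forall>n. G n \<in> events) \<and> (\<lambda>n. prob (G n)) \<longlonglongrightarrow> 1 \<and>
    (\<forall>n. \<forall>\<omega>\<in>G n. \<bar>real (card {i \<in> {1..n}. W i \<omega> \<in> D n}) - real n * measure \<mu> (D n)\<bar>
        \<le> real n * measure \<mu> (D n) / 4)"
proof -
  define mu where "mu = (\<lambda>n. real n * measure \<mu> (D n))"
  define A where "A = (\<lambda>n i. W i -` D n \<inter> space M)"
  define S where "S = (\<lambda>n \<omega>. \<Sum>i\<in>{1..n}. indicator (A n i) \<omega> :: real)"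
  have W[measurable]: "W i \<in> borel_measurable M" if "i \<ge> 1" for i
    using indep that unfolding indep_vars_def by auto
  have A: "A n i \<in> events" if "i \<ge> 1" for n i
    unfolding A_def using W[OF that] D by (rule measurable_sets)
  have p: "prob (A n i) = measure \<mu> (D n)" if "i \<ge> 1" for n i
    unfolding A_def law[OF that, symmetric] using W[OF that] D by (simp add: measure_distr)
  have pp: "prob (A n i \<inter> A n j) = measure \<mu> (D n) * measure \<mu> (D n)"
    if "i \<ge> 1" "j \<ge> 1" "i \<noteq> j" for n i j
  proof -
    have "prob (\<Inter>l\<in>{i, j}. W l -` D n \<inter> space M) = (\<Prod>l\<in>{i, j}. prob (W l -` D n \<inter> space M))"
      by (rule indep_varsD[OF indep]) (use that D in auto)
    then have "prob (A n i \<inter> A n j) = prob (A n i) * prob (A n j)" using that by (simp add: A_def)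
    then show ?thesis using that p by simp
  qed
  have Smeas[measurable]: "S n \<in> borel_measurable M" for n unfolding S_def using A by measurable
  define H where "H = (\<lambda>n. {\<omega> \<in> space M. mu n / 4 \<le> \<bar>S n \<omega> - mu n\<bar>})"
  \<comment> \<open>the second set matters only if \<open>mu n = 0\<close>, where the deviation event \<open>H n\<close> is all of \<open>space M\<close>\<close>
  define G where "G = (\<lambda>n. space M - H n \<union> {\<omega> \<in> space M. S n \<omega> = mu n})"
  have Hev[measurable]: "H n \<in> events" for n unfolding H_def by measurable
  have Gev: "G n \<in> events" for n unfolding G_def by measurable
  have bound: "prob (H n) \<le> 16 / mu n" if "0 < mu n" for n
  proof -
    have "prob (H n) \<le> real (card {1..n}) * measure \<mu> (D n) / (mu n / 4)\<^sup>2"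
      using count_Chebyshev[of "{1..n}" "A n" "measure \<mu> (D n)" "mu n / 4"] A p pp that
      by (simp add: H_def S_def mu_def)
    also have "\<dots> = 16 / mu n" using that by (simp add: mu_def power2_eq_square)
    finally show ?thesis .
  qed
  have "(\<lambda>n. 16 / mu n) \<longlonglongrightarrow> 0"
    using large unfolding mu_def[symmetric] by (intro real_tendsto_divide_at_top) auto
  moreover have "\<forall>\<^sub>F n in sequentially. 0 < mu n"
    using large unfolding mu_def[symmetric] by (simp add: filterlim_at_top_dense)
  then have "\<forall>\<^sub>F n in sequentially. 1 - 16 / mu n \<le> prob (G n)"
  proof eventually_elim
    case (elim n)
    have "1 - prob (H n) = prob (space M - H n)" using Hev by (simp add: prob_compl)
    also have "\<dots> \<le> prob (G n)" by (rule finite_measure_mono) (use Gev in \<open>auto simp: G_def\<close>)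
    finally show ?case using bound[OF elim] by simp
  qed
  ultimately have "(\<lambda>n. prob (G n)) \<longlonglongrightarrow> 1"
    by (intro tendsto_sandwich[of "\<lambda>n. 1 - 16 / mu n" "\<lambda>n. prob (G n)" _ "\<lambda>_. 1" 1])
       (auto intro: tendsto_eq_intros)
  moreover have "\<bar>real (card {i \<in> {1..n}. W i \<omega> \<in> D n}) - mu n\<bar> \<le> mu n / 4" if "\<omega> \<in> G n" for n \<omega>
  proof -
    have "\<omega> \<in> space M" using that by (auto simp: G_def)
    then have "S n \<omega> = (\<Sum>i\<in>{1..n}. of_bool (W i \<omega> \<in> D n))"
      unfolding S_def A_def by (intro sum.cong) (auto simp: indicator_def)
    also have "\<dots> = real (card {i \<in> {1..n}. W i \<omega> \<in> D n})"
      by (subst sum_of_bool_eq) (auto intro!: arg_cong[where f = card])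
    finally show ?thesis using that by (auto simp: G_def H_def mu_def)
  qed
  ultimately show ?thesis using Gev unfolding mu_def by blast
qed

lemma (in prob_space) tendsto_prob_Int:
  assumes "\<And>n. A n \<in> events" "\<And>n. B n \<in> events"
    and "(\<lambda>n. prob (A n)) \<longlonglongrightarrow> 1" "(\<lambda>n. prob (B n)) \<longlonglongrightarrow> 1"
  shows "(\<lambda>n. prob (A n \<inter> B n)) \<longlonglongrightarrow> 1"
proof (rule tendsto_sandwich)
  show "\<forall>\<^sub>F n in sequentially. prob (A n) + prob (B n) - 1 \<le> prob (A n \<inter> B n)"
  proof (rule always_eventually, rule allI)
    fix n
    have "prob (A n \<union> B n) = prob (A n) + prob (B n) - prob (A n \<inter> B n)"
      using assms by (intro measure_Un3) (auto simp: fmeasurable_eq_sets)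
    then show "prob (A n) + prob (B n) - 1 \<le> prob (A n \<inter> B n)" using prob_le_1[of "A n \<union> B n"] by linarith
  qed
  show "(\<lambda>n. prob (A n) + prob (B n) - 1) \<longlonglongrightarrow> 1" using assms by (auto intro!: tendsto_eq_intros)
qed auto

section \<open>The quantile function of the minimum\<close>

lemma neg_log_nonneg: "u \<le> 1 \<Longrightarrow> 0 \<le> neg_log u"
  by (auto simp: neg_log_def ln_le_zero_iff)

lemma ereal_one_divide_nonneg: "0 \<le> a \<Longrightarrow> 0 \<le> 1 / (a :: ereal)"
  by (cases a) (auto simp: one_ereal_def divide_ereal_def)

lemma ereal_one_divide_max:
  fixes a b :: ereal
  assumes "0 \<le> a" "0 \<le> b"
  shows "1 / max a b = min (1 / a) (1 / b)"
proof -
  have anti: "1 / y \<le> 1 / x" if "0 \<le> x" "x \<le> y" for x y :: ereal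
    using that by (simp add: divide_ereal_def ereal_inverse_antimono)
  show ?thesis using anti[of a b] anti[of b a] assms by (auto simp: max_def min_def)
qed

lemma neg_log_measurable [measurable]: "neg_log \<in> borel_measurable borel"
  unfolding neg_log_def[abs_def] by measurable

text \<open>
  This is \<open>- ln (1 - a) \<le> a / (1 - a)\<close>.  It lets \<open>1 / (- ln F\<^sub>Z)\<close> be compared with \<open>1 / (1 - F\<^sub>Z)\<close> at the cost of
  a shift of the argument by one.
\<close>
lemma le_one_divide_neg_log:
  fixes a t :: real
  assumes t: "0 < t" and a: "0 \<le> a" "a \<le> 1 / (t + 1)"
  shows "ereal t \<le> 1 / neg_log (1 - a)"
proof (cases "a = 0")
  case True
  then show ?thesis by (simp add: neg_log_def one_ereal_def)
next
  case False
  have "1 / (t + 1) < 1" using t by simp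
  then have a1: "0 < a" "a < 1" using False a by linarith+
  have "- ln (1 - a) = ln (1 / (1 - a))" using a1 by (simp add: ln_div)
  also have "\<dots> \<le> 1 / (1 - a) - 1" using a1 by (intro ln_le_minus_one) auto
  also have "\<dots> = a / (1 - a)" using a1 by (simp add: field_simps)
  also have "\<dots> \<le> 1 / t" using a a1 t by (simp add: field_simps)
  finally have le: "- ln (1 - a) \<le> 1 / t" .
  moreover have pos: "0 < - ln (1 - a)" using a1 by simp
  ultimately have "t \<le> 1 / (- ln (1 - a))" using t by (simp add: field_simps)
  then show ?thesis using a1 pos by (simp add: neg_log_def one_ereal_def)
qed

context prob_space
begin

lemma marginal_cdf_le_1: "X \<in> borel_measurable M \<Longrightarrow> marginal_cdf M X x \<le> 1"
  by (intro real_distribution.cdf_bounded_prob real_distribution_distr)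

lemma marginal_cdf_measurable [measurable]:
  assumes "X \<in> borel_measurable M" shows "marginal_cdf M X \<in> borel_measurable borel"
proof (rule borel_measurable_mono)
  interpret XD: real_distribution "distr M borel X" using assms by (rule real_distribution_distr)
  show "mono (marginal_cdf M X)" by (simp add: mono_def XD.cdf_nondecreasing)
qed

lemma alpha_nonneg: "0 \<le> alpha M X Y t" by (simp add: alpha_def)

lemma alpha_antimono:
  assumes [measurable]: "X \<in> borel_measurable M" "Y \<in> borel_measurable M" and "s \<le> t"
  shows "alpha M X Y t \<le> alpha M X Y s"
  unfolding alpha_def
proof (rule finite_measure_mono)
  have "ereal s \<le> ereal t" using \<open>s \<le> t\<close> by simp
  then show "{\<omega> \<in> space M. ereal t < 1 / neg_log (marginal_cdf M X (X \<omega>)) + ereal (1 / 2) \<and>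
           ereal t < 1 / neg_log (marginal_cdf M Y (Y \<omega>)) + ereal (1 / 2)}
    \<subseteq> {\<omega> \<in> space M. ereal s < 1 / neg_log (marginal_cdf M X (X \<omega>)) + ereal (1 / 2) \<and>
           ereal s < 1 / neg_log (marginal_cdf M Y (Y \<omega>)) + ereal (1 / 2)}"
    by (auto dest: le_less_trans[OF \<open>ereal s \<le> ereal t\<close>] simp del: ereal_less_eq)
qed measurable

lemma F_Z_eq:
  assumes [measurable]: "X \<in> borel_measurable M" "Y \<in> borel_measurable M"
  shows "F_Z M X Y z = 1 - alpha M X Y z"
proof -
  let ?E = "{\<omega> \<in> space M. ereal z < 1 / neg_log (marginal_cdf M X (X \<omega>)) + ereal (1 / 2) \<and>
           ereal z < 1 / neg_log (marginal_cdf M Y (Y \<omega>)) + ereal (1 / 2)}"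
  have "{\<omega> \<in> space M. Z_var M X Y \<omega> \<le> ereal z} = space M - ?E"
  proof -
    have "Z_var M X Y \<omega> = min (1 / neg_log (marginal_cdf M X (X \<omega>)) + ereal (1 / 2))
        (1 / neg_log (marginal_cdf M Y (Y \<omega>)) + ereal (1 / 2))" for \<omega>
      unfolding Z_var_def
      by (subst ereal_one_divide_max) (auto simp: neg_log_nonneg marginal_cdf_le_1 min_def ereal_add_le_add_iff2 not_le split: if_splits)
    then show ?thesis by (auto simp: min_le_iff_disj not_less)
  qed
  moreover have "?E \<in> events" by measurable
  ultimately show ?thesis unfolding F_Z_def alpha_def by (simp add: prob_compl)
qed

lemma alpha_eq_1:
  assumes XY: "X \<in> borel_measurable M" "Y \<in> borel_measurable M" and z: "z < 1 / 2"
  shows "alpha M X Y z = 1"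
proof -
  have "ereal z < 1 / neg_log (marginal_cdf M X x) + ereal (1 / 2)" if "X \<in> borel_measurable M" for X x
  proof -
    have "ereal z < 0 + ereal (1 / 2)" using z by simp
    also have "\<dots> \<le> 1 / neg_log (marginal_cdf M X x) + ereal (1 / 2)"
      by (intro add_right_mono ereal_one_divide_nonneg neg_log_nonneg marginal_cdf_le_1 that)
    finally show ?thesis .
  qed
  then have "{\<omega> \<in> space M. ereal z < 1 / neg_log (marginal_cdf M X (X \<omega>)) + ereal (1 / 2) \<and>
           ereal z < 1 / neg_log (marginal_cdf M Y (Y \<omega>)) + ereal (1 / 2)} = space M"
    using XY by auto
  then show ?thesis unfolding alpha_def by (simp add: prob_space)
qed

text \<open>
  The third part is the link between the threshold and the quantile function: a level \<open>z\<close> at which the joint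
  tail is small enough belongs to the set whose infimum defines \<open>V\<^sup>\<star>\<close>.  The infimum is a meaningful one: the
  set is nonempty, since \<open>\<alpha>\<close> vanishes at infinity, and bounded below by \<open>1/2\<close>, since \<open>Z \<ge> 1/2\<close>.
\<close>
lemma V_star_properties:
  assumes XY: "X \<in> borel_measurable M" "Y \<in> borel_measurable M"
    and lim: "(alpha M X Y \<longlongrightarrow> 0) at_top"
  shows V_star_ge_1: "0 < t \<Longrightarrow> 1 \<le> V_star M X Y t"
    and V_star_mono: "0 < t \<Longrightarrow> t \<le> t' \<Longrightarrow> V_star M X Y t \<le> V_star M X Y t'"
    and V_star_le: "0 < t \<Longrightarrow> alpha M X Y z \<le> 1 / (t + 1) \<Longrightarrow> V_star M X Y t \<le> z + 1 / 2"
proof -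
  define S where "S = (\<lambda>t. {z. ereal t \<le> 1 / neg_log (F_Z M X Y z)})"
  have V: "V_star M X Y t = 1 / 2 + Inf (S t)" for t
    by (simp add: V_star_def gen_inverse_def S_def)
  have mem: "z \<in> S t" if "0 < t" "alpha M X Y z \<le> 1 / (t + 1)" for t z
    unfolding S_def mem_Collect_eq F_Z_eq[OF XY] using that alpha_nonneg by (intro le_one_divide_neg_log)
  have ne: "S t \<noteq> {}" if "0 < t" for t
  proof -
    have "\<forall>\<^sub>F z in at_top. alpha M X Y z < 1 / (t + 1)"
      using lim that by (intro order_tendstoD(2)[OF lim]) auto
    then obtain z where "alpha M X Y z < 1 / (t + 1)" by (auto simp: eventually_at_top_linorder)
    then show ?thesis using mem[OF that, of z] by auto
  qed
  have lb: "1 / 2 \<le> z" if "0 < t" "z \<in> S t" for t z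
  proof (rule ccontr)
    assume "\<not> 1 / 2 \<le> z"
    then have "F_Z M X Y z = 0" using alpha_eq_1[OF XY, of z] by (simp add: F_Z_eq[OF XY])
    then show False using that by (simp add: S_def neg_log_def)
  qed
  have bdd: "bdd_below (S t)" if "0 < t" for t using lb[OF that] by (meson bdd_below.I)
  show "1 \<le> V_star M X Y t" if "0 < t"
    using cInf_greatest[OF ne[OF that], of "1 / 2"] lb[OF that] by (simp add: V)
  show "V_star M X Y t \<le> V_star M X Y t'" if "0 < t" "t \<le> t'"
  proof -
    have "ereal t \<le> ereal t'" using that by simp
    then have "S t' \<subseteq> S t" unfolding S_def using order_trans by blast
    then show ?thesis using that by (auto simp: V intro!: cInf_superset_mono ne bdd)
  qed
  show "V_star M X Y t \<le> z + 1 / 2" if "0 < t" "alpha M X Y z \<le> 1 / (t + 1)"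
    using cInf_lower[OF mem[OF that] bdd[OF that(1)]] by (simp add: V)
qed

end

section \<open>The threshold against the second order remainder\<close>

text \<open>
  A second order condition implies the first order one.
\<close>
lemma tendsto_of_quotient_tendsto:
  fixes f b :: "real \<Rightarrow> real"
  assumes "((\<lambda>t. (f t - l) / b t) \<longlongrightarrow> k) F" "(b \<longlongrightarrow> 0) F" "\<forall>\<^sub>F t in F. b t \<noteq> 0"
  shows "(f \<longlongrightarrow> l) F"
proof -
  have "((\<lambda>t. (f t - l) / b t * b t + l) \<longlongrightarrow> k * 0 + l) F"
    by (intro tendsto_intros assms)
  moreover have "\<forall>\<^sub>F t in F. (f t - l) / b t * b t + l = f t"
    using assms(3) by eventually_elim simp
  ultimately show ?thesis by (auto dest: Lim_transform_eventually)
qed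

context prob_space
begin

lemma V_star_exp_measurable:
  assumes "X \<in> borel_measurable M" "Y \<in> borel_measurable M" "(alpha M X Y \<longlongrightarrow> 0) at_top"
    and "0 < a"
  shows "(\<lambda>x. V_star M X Y (a * exp x)) \<in> borel_measurable borel"
  by (rule borel_measurable_mono) (use assms in \<open>auto simp: mono_def intro!: V_star_mono[OF assms(1-3)]\<close>)

text \<open>
  Regular variation of \<open>|B|\<close> alone gives no lower bound, because \<open>B\<close> need not be measurable.  But the second order
  condition at \<open>x = 2\<close> says that \<open>B\<close> is, up to a nonzero constant factor, asymptotic to
  \<open>Q t = V\<^sup>\<star>(2 t) / V\<^sup>\<star>(t) - 2 powr \<eta>\<close>, which is measurable because \<open>V\<^sup>\<star>\<close> is monotone and which inherits the
  regular variation.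
\<close>
lemma second_order_B_lower_bound:
  assumes XY: "X \<in> borel_measurable M" "Y \<in> borel_measurable M"
    and lim: "(alpha M X Y \<longlongrightarrow> 0) at_top"
    and so: "second_order_V_star M X Y B \<eta> \<tau>" and e: "0 < \<epsilon>"
  shows "\<exists>c>0. \<forall>\<^sub>F t in at_top. c * t powr (- \<tau> - \<epsilon>) \<le> \<bar>B t\<bar>"
    and "\<forall>\<^sub>F t in at_top. B t \<noteq> 0"
proof -
  \<comment> \<open>the limit of the second order condition at \<open>x = 2\<close>\<close>
  define h where "h = 2 powr \<eta> * (if \<tau> = 0 then - ln 2 else (2 powr (- \<tau>) - 1) / \<tau>)"
  define Q where "Q = (\<lambda>t. V_star M X Y (t * 2) / V_star M X Y t - 2 powr \<eta>)"
  have QB: "((\<lambda>t. Q t / B t) \<longlongrightarrow> h) at_top"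
    using so unfolding second_order_V_star_def Q_def h_def by fastforce
  have rv: "regularly_varying (\<lambda>t. \<bar>B t\<bar>) (- \<tau>)"
    using so by (simp add: second_order_V_star_def)
  have h: "h \<noteq> 0"
  proof (cases "\<tau> = 0")
    case False
    have "2 powr (- \<tau>) \<noteq> 2 powr (0::real)" using False by (subst powr_inj) auto
    then show ?thesis using False by (simp add: h_def)
  qed (simp add: h_def)
  define P where "P = (\<lambda>t. \<bar>Q t / B t\<bar>)"
  have P: "(P \<longlongrightarrow> \<bar>h\<bar>) at_top" unfolding P_def by (intro tendsto_rabs QB)
  have Ppos: "\<forall>\<^sub>F t in at_top. 0 < P t"
    using P h by (intro order_tendstoD(1)) auto
  then show nz: "\<forall>\<^sub>F t in at_top. B t \<noteq> 0" by eventually_elim (auto simp: P_def)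
  have Qpos: "\<forall>\<^sub>F t in at_top. 0 < \<bar>Q t\<bar>" using Ppos by eventually_elim (auto simp: P_def)
  have "regularly_varying (\<lambda>t. \<bar>Q t\<bar>) (- \<tau>)"
    unfolding regularly_varying_def
  proof (intro allI impI)
    fix x :: real assume x: "0 < x"
    have top: "filterlim (\<lambda>t. t * x) at_top at_top"
      by (rule filterlim_at_top_mult_tendsto_pos[OF tendsto_const x filterlim_ident])
    have "((\<lambda>t. P (t * x) * (\<bar>B (t * x)\<bar> / \<bar>B t\<bar>) / P t) \<longlongrightarrow> \<bar>h\<bar> * x powr (- \<tau>) / \<bar>h\<bar>) at_top"
      using rv x h unfolding regularly_varying_def
      by (intro tendsto_intros P filterlim_compose[OF P top]) auto
    moreover have "\<forall>\<^sub>F t in at_top. P (t * x) * (\<bar>B (t * x)\<bar> / \<bar>B t\<bar>) / P t = \<bar>Q (t * x)\<bar> / \<bar>Q t\<bar>"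
      using eventually_compose_filterlim[OF nz top] nz Qpos
      by eventually_elim (simp add: P_def field_simps)
    ultimately have "((\<lambda>t. \<bar>Q (t * x)\<bar> / \<bar>Q t\<bar>) \<longlongrightarrow> \<bar>h\<bar> * x powr (- \<tau>) / \<bar>h\<bar>) at_top"
      by (rule Lim_transform_eventually)
    then show "((\<lambda>t. \<bar>Q (t * x)\<bar> / \<bar>Q t\<bar>) \<longlongrightarrow> x powr (- \<tau>)) at_top" using h by simp
  qed
  moreover have "(\<lambda>x. \<bar>Q (exp x)\<bar>) \<in> borel_measurable borel"
    using V_star_exp_measurable[OF XY lim, of 2] V_star_exp_measurable[OF XY lim, of 1]
    unfolding Q_def by (simp add: mult.commute)
  ultimately obtain c where c: "0 < c" "\<forall>\<^sub>F t in at_top. c * t powr (- \<tau> - \<epsilon>) \<le> \<bar>Q t\<bar>"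
    using regularly_varying_lower_bound[OF _ Qpos _ e] by blast
  have "\<forall>\<^sub>F t in at_top. P t < 2 * \<bar>h\<bar>" using P h by (intro order_tendstoD(2)) auto
  with c(2) nz have "\<forall>\<^sub>F t in at_top. c / (2 * \<bar>h\<bar>) * t powr (- \<tau> - \<epsilon>) \<le> \<bar>B t\<bar>"
  proof eventually_elim
    case (elim t)
    then have "\<bar>Q t\<bar> \<le> 2 * \<bar>h\<bar> * \<bar>B t\<bar>" by (simp add: P_def field_simps)
    then show ?case using elim h by (simp add: field_simps)
  qed
  moreover have "0 < c / (2 * \<bar>h\<bar>)" using c h by simp
  ultimately show "\<exists>c>0. \<forall>\<^sub>F t in at_top. c * t powr (- \<tau> - \<epsilon>) \<le> \<bar>B t\<bar>" by blast
qed

lemma V_star_lower_bound: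
  assumes XY: "X \<in> borel_measurable M" "Y \<in> borel_measurable M"
    and lim: "(alpha M X Y \<longlongrightarrow> 0) at_top"
    and so: "second_order_V_star M X Y B \<eta> \<tau>" and e: "0 < \<epsilon>"
  shows "\<exists>c>0. \<forall>\<^sub>F t in at_top. c * t powr (\<eta> - \<epsilon>) \<le> V_star M X Y t"
proof (rule regularly_varying_lower_bound[OF _ _ _ e])
  show "(\<lambda>x. V_star M X Y (exp x)) \<in> borel_measurable borel"
    using V_star_exp_measurable[OF XY lim, of 1] by simp
  show "\<forall>\<^sub>F t in at_top. 0 < V_star M X Y t"
    using eventually_gt_at_top[of 0]
  proof eventually_elim
    case (elim t)
    show ?case using V_star_ge_1[OF XY lim elim] by linarith
  qed
  show "regularly_varying (V_star M X Y) \<eta>"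
    unfolding regularly_varying_def
  proof (intro allI impI)
    fix x :: real assume "0 < x"
    then have "((\<lambda>t. (V_star M X Y (t * x) / V_star M X Y t - x powr \<eta>) / B t) \<longlongrightarrow>
        x powr \<eta> * (if \<tau> = 0 then - ln x else (x powr (- \<tau>) - 1) / \<tau>)) at_top" and "(B \<longlongrightarrow> 0) at_top"
      using so unfolding second_order_V_star_def by auto
    then show "((\<lambda>t. V_star M X Y (t * x) / V_star M X Y t) \<longlongrightarrow> x powr \<eta>) at_top"
      by (rule tendsto_of_quotient_tendsto) (rule second_order_B_lower_bound(2)[OF XY lim so zero_less_one])
  qed
qed

text \<open>
  With \<open>T = n / m\<close> and a loss of \<open>\<eta> / 4\<close> in each exponent, \<open>V\<^sup>\<star>(T - 1)\<close> is at least of order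
  \<open>T powr (3/4 * \<eta>)\<close>.  Hence \<open>s\<^sup>-\<^sup>2\<close> is at most of order \<open>T powr (- 3/2 * \<eta>)\<close>, while \<open>|B T|\<close> is at least of order
  \<open>T powr (- \<tau> - \<eta> / 4)\<close> with \<open>\<tau> + \<eta> / 4 \<le> 5/4 * \<eta>\<close>.
\<close>
lemma sqrt_over_threshold_square_tendsto_0:
  fixes m :: "nat \<Rightarrow> nat" and s :: "nat \<Rightarrow> real"
  assumes XY: "X \<in> borel_measurable M" "Y \<in> borel_measurable M"
    and lim: "(alpha M X Y \<longlongrightarrow> 0) at_top"
    and so: "second_order_V_star M X Y B \<eta> \<tau>" and \<tau>: "\<tau> \<le> \<eta>" and \<eta>: "0 < \<eta>"
    and s: "filterlim s at_top sequentially"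
    and m: "\<And>n. 1 \<le> n \<Longrightarrow> 0 < m n \<and> real (m n) = real n * alpha M X Y (s n)"
    and B: "(\<lambda>n. sqrt (real (m n)) * B (real n / real (m n))) \<longlonglongrightarrow> 0"
  shows "(\<lambda>n. sqrt (real (m n)) / (s n)\<^sup>2) \<longlonglongrightarrow> 0"
proof -
  define T where "T = (\<lambda>n. real n / real (m n))"
  have alpha_T: "alpha M X Y (s n) = 1 / T n" "0 < T n" if "1 \<le> n" for n
  proof -
    have "0 < real (m n)" "0 < real n" "real (m n) = real n * alpha M X Y (s n)" using m[OF that] that by auto
    then show "alpha M X Y (s n) = 1 / T n" "0 < T n" by (auto simp: T_def zero_less_mult_iff)
  qed
  have "(\<lambda>n. alpha M X Y (s n)) \<longlonglongrightarrow> 0" by (rule filterlim_compose[OF lim s])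
  then have "filterlim (\<lambda>n. inverse (alpha M X Y (s n))) at_top sequentially"
    using eventually_mono[OF eventually_ge_at_top[of "1::nat"]] alpha_T
    by (intro filterlim_inverse_at_top) auto
  moreover have "\<forall>\<^sub>F n in sequentially. inverse (alpha M X Y (s n)) = T n"
    using eventually_ge_at_top[of "1::nat"] by eventually_elim (simp add: alpha_T)
  ultimately have T: "filterlim T at_top sequentially"
    using filterlim_cong by fast
  have T1: "filterlim (\<lambda>n. T n - 1) at_top sequentially"
    using filterlim_tendsto_add_at_top[OF tendsto_const[of "-1"] T] by simp
  obtain c where c: "0 < c" "\<forall>\<^sub>F t in at_top. c * t powr (\<eta> - \<eta> / 4) \<le> V_star M X Y t"
    using V_star_lower_bound[OF XY lim so, of "\<eta> / 4"] \<eta> by auto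
  obtain b where b: "0 < b" "\<forall>\<^sub>F t in at_top. b * t powr (- \<tau> - \<eta> / 4) \<le> \<bar>B t\<bar>"
    using second_order_B_lower_bound(1)[OF XY lim so, of "\<eta> / 4"] \<eta> by auto
  define C where "C = (c / 2 * (1 / 2) powr (3 / 4 * \<eta>))\<^sup>2"
  have C: "0 < C" using c by (simp add: C_def)
  have "\<forall>\<^sub>F n in sequentially. sqrt (real (m n)) / (s n)\<^sup>2 \<le> \<bar>sqrt (real (m n)) * B (T n)\<bar> / (C * b)"
    using eventually_compose_filterlim[OF c(2) T1] eventually_compose_filterlim[OF b(2) T]
      eventually_compose_filterlim[OF eventually_ge_at_top[of 2] T] eventually_ge_at_top[of "1::nat"]
  proof eventually_elim
    case (elim n)
    have "1 \<le> V_star M X Y (T n - 1)" using elim by (intro V_star_ge_1[OF XY lim]) auto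
    moreover have "V_star M X Y (T n - 1) \<le> s n + 1 / 2"
      using elim by (intro V_star_le[OF XY lim]) (auto simp: alpha_T)
    ultimately have "V_star M X Y (T n - 1) / 2 \<le> s n" by linarith
    moreover have "c * (1 / 2 * T n) powr (3 / 4 * \<eta>) \<le> c * (T n - 1) powr (3 / 4 * \<eta>)"
      using elim c \<eta> by (intro mult_left_mono powr_mono2) auto
    ultimately have "c / 2 * (1 / 2 * T n) powr (3 / 4 * \<eta>) \<le> s n" using elim by (simp add: algebra_simps)
    then have "c / 2 * (1 / 2) powr (3 / 4 * \<eta>) * T n powr (3 / 4 * \<eta>) \<le> s n"
      using elim by (simp only: powr_mult mult.assoc)
    then have "(c / 2 * (1 / 2) powr (3 / 4 * \<eta>) * T n powr (3 / 4 * \<eta>))\<^sup>2 \<le> (s n)\<^sup>2"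
      using c by (intro power_mono) auto
    also have "(c / 2 * (1 / 2) powr (3 / 4 * \<eta>) * T n powr (3 / 4 * \<eta>))\<^sup>2 = C * T n powr (3 / 2 * \<eta>)"
    proof -
      have "(T n powr (3 / 4 * \<eta>))\<^sup>2 = T n powr (3 / 2 * \<eta>)"
        by (simp add: power2_eq_square powr_add[symmetric])
      then show ?thesis by (simp only: C_def power_mult_distrib)
    qed
    finally have s2: "C * T n powr (3 / 2 * \<eta>) \<le> (s n)\<^sup>2" .
    have "1 / (s n)\<^sup>2 \<le> 1 / (C * T n powr (3 / 2 * \<eta>))"
    proof -
      have "0 < C * T n powr (3 / 2 * \<eta>)" using C elim by simp
      then show ?thesis using s2 by (intro frac_le) auto
    qed
    also have "\<dots> = T n powr (- (3 / 2 * \<eta>)) / C" by (simp add: powr_minus field_simps)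
    also have "\<dots> \<le> T n powr (- \<tau> - \<eta> / 4) / C"
      using elim C \<tau> \<eta> by (intro divide_right_mono powr_mono) auto
    also have "\<dots> \<le> \<bar>B (T n)\<bar> / (C * b)" using elim C b by (simp add: field_simps)
    finally have "sqrt (real (m n)) * (1 / (s n)\<^sup>2) \<le> sqrt (real (m n)) * (\<bar>B (T n)\<bar> / (C * b))"
      by (intro mult_left_mono) auto
    then show ?case by (simp add: abs_mult)
  qed
  moreover have "(\<lambda>n. \<bar>sqrt (real (m n)) * B (T n)\<bar> / (C * b)) \<longlonglongrightarrow> 0"
    using tendsto_divide[OF tendsto_rabs[OF B] tendsto_const[of "C * b"]] C b by (simp add: T_def)
  ultimately show ?thesis
    by (intro tendsto_sandwich[where f = "\<lambda>_. 0" and g = "\<lambda>n. sqrt (real (m n)) / (s n)\<^sup>2"]) auto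
qed

end

section \<open>Locating the extreme order statistics\<close>

text \<open>
  \<open>n - sample_rank n x i\<close> is the number of strictly larger sample values, and \<open>N x\<close> is the number of values whose
  \<open>F\<close>-image lies in the top \<open>p\<close>.  A value in the top \<open>p\<close> counts itself and all larger ones; a value
  outside lies strictly below the whole top.
\<close>
lemma sample_rank_exceedances:
  fixes F :: "real \<Rightarrow> real" and p :: real and n :: nat
  defines "N \<equiv> \<lambda>x. card {j \<in> {1..n}. 1 - F (x j) < p}"
  assumes F: "mono F" and i: "i \<in> {1..n}"
  shows rank_le_exceedances: "1 - F (x i) < p \<Longrightarrow> real n + 1 - real (sample_rank n x i) \<le> real (N x)"
    and exceedances_less_rank: "p \<le> 1 - F (x i) \<Longrightarrow> real (N x) + 1 \<le> real n + 1 - real (sample_rank n x i)"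
proof -
  define A where "A = {j \<in> {1..n}. x i < x j}"
  have A: "finite A" "i \<notin> A" by (auto simp: A_def)
  have rank: "real (sample_rank n x i) = real n - real (card A)"
  proof -
    have "sample_rank n x i = card {j \<in> {1..n}. x j \<le> x i}"
      unfolding sample_rank_def by (subst sum_of_bool_eq) (auto intro!: arg_cong[where f = card])
    also have "{j \<in> {1..n}. x j \<le> x i} = {1..n} - A" by (auto simp: A_def)
    also have "card \<dots> = n - card A" by (subst card_Diff_subset) (auto simp: A_def)
    finally have "sample_rank n x i = n - card A" .
    moreover have "card A \<le> card {1..n}" by (rule card_mono) (auto simp: A_def)
    ultimately show ?thesis by simp
  qed
  have Fi: "F (x i) \<le> F (x j)" if "x i \<le> x j" for j using F that by (rule monoD)
  show "real n + 1 - real (sample_rank n x i) \<le> real (N x)" if "1 - F (x i) < p"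
  proof -
    have "insert i A \<subseteq> {j \<in> {1..n}. 1 - F (x j) < p}"
    proof
      fix j assume "j \<in> insert i A"
      then have "j \<in> {1..n}" "x i \<le> x j" using i by (auto simp: A_def)
      then show "j \<in> {j \<in> {1..n}. 1 - F (x j) < p}" using Fi[of j] that by auto
    qed
    then have "card (insert i A) \<le> N x" unfolding N_def by (intro card_mono) auto
    then show ?thesis using A by (simp add: rank)
  qed
  show "real (N x) + 1 \<le> real n + 1 - real (sample_rank n x i)" if p: "p \<le> 1 - F (x i)"
  proof -
    have "{j \<in> {1..n}. 1 - F (x j) < p} \<subseteq> A"
    proof clarify
      fix j assume j: "j \<in> {1..n}" "1 - F (x j) < p"
      have "F (x j) \<le> F (x i)" if "x j \<le> x i" using F that by (rule monoD)
      then have "x i < x j" using j p by argo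
      then show "j \<in> A" using j by (simp add: A_def)
    qed
    then have "N x \<le> card A" unfolding N_def by (intro card_mono A)
    then show ?thesis by (simp add: rank)
  qed
qed

lemma pseudo_T_gt_iff:
  assumes i: "i \<in> {1..n}" and v: "0 < v"
  shows "v < pseudo_T n x y i \<longleftrightarrow> real n + 1 - real (sample_rank n x i) < (real n + 1) / v
    \<and> real n + 1 - real (sample_rank n y i) < (real n + 1) / v"
proof -
  have "0 < real n + 1 - real (sample_rank n x i)" "0 < real n + 1 - real (sample_rank n y i)"
    using sample_rank_bounds[OF i, of x] sample_rank_bounds[OF i, of y] by auto
  then show ?thesis using v by (simp add: pseudo_T_def field_simps)
qed

context
  fixes n :: nat and x y :: "nat \<Rightarrow> real" and F G :: "real \<Rightarrow> real" and p v :: real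
  assumes mono: "mono F" "mono G" and v: "0 < v"
begin

text \<open>
  The marginal hypotheses say that a value in the top \<open>p\<close> of its distribution also has a
  rank high enough for its Pareto pseudo-value to exceed \<open>v\<close>.
\<close>
lemma order_stat_pseudo_T_gt:
  assumes "real (card {i \<in> {1..n}. 1 - F (x i) < p}) < (real n + 1) / v"
    and "real (card {i \<in> {1..n}. 1 - G (y i) < p}) < (real n + 1) / v"
    and j: "j < n" "j < card {i \<in> {1..n}. 1 - F (x i) < p \<and> 1 - G (y i) < p}"
  shows "v < order_stat n (pseudo_T n x y) (n - j)"
proof -
  have "{i \<in> {1..n}. 1 - F (x i) < p \<and> 1 - G (y i) < p} \<subseteq> {i \<in> {1..n}. v < pseudo_T n x y i}"
  proof clarify
    fix i assume i: "i \<in> {1..n}" "1 - F (x i) < p" "1 - G (y i) < p"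
    show "v < pseudo_T n x y i"
      unfolding pseudo_T_gt_iff[OF i(1) v]
      using rank_le_exceedances[where F = F and x = x, OF mono(1) i(1,2)]
        rank_le_exceedances[where F = G and x = y, OF mono(2) i(1,3)] assms
      by linarith
  qed
  from card_mono[OF _ this] show ?thesis using j by (simp add: order_stat_gt_iff)
qed

text \<open>
  Conversely, the marginal hypotheses here say that only values in the top \<open>p\<close> can have a Pareto pseudo-value
  exceeding \<open>v\<close>.
\<close>
lemma order_stat_pseudo_T_le:
  assumes "(real n + 1) / v \<le> real (card {i \<in> {1..n}. 1 - F (x i) < p}) + 1"
    and "(real n + 1) / v \<le> real (card {i \<in> {1..n}. 1 - G (y i) < p}) + 1"
    and j: "j < n" "card {i \<in> {1..n}. 1 - F (x i) < p \<and> 1 - G (y i) < p} \<le> j"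
  shows "order_stat n (pseudo_T n x y) (n - j) \<le> v"
proof -
  have "{i \<in> {1..n}. v < pseudo_T n x y i} \<subseteq> {i \<in> {1..n}. 1 - F (x i) < p \<and> 1 - G (y i) < p}"
  proof clarify
    fix i assume i: "i \<in> {1..n}" "v < pseudo_T n x y i"
    show "1 - F (x i) < p \<and> 1 - G (y i) < p"
    proof (rule ccontr)
      assume "\<not> ?thesis"
      then have "p \<le> 1 - F (x i) \<or> p \<le> 1 - G (y i)" by auto
      then show False
        using i(2) exceedances_less_rank[where p = p and x = x, OF mono(1) i(1)]
          exceedances_less_rank[where p = p and x = y, OF mono(2) i(1)] assms
        unfolding pseudo_T_gt_iff[OF i(1) v] by linarith
    qed
  qed
  from card_mono[OF _ this] have "card {i \<in> {1..n}. v < pseudo_T n x y i} \<le> j" using j by simp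
  then show ?thesis using j order_stat_gt_iff[of j n v "pseudo_T n x y"] by linarith
qed

end

context prob_space
begin

text \<open>
  The probability integral transform, for a continuous marginal: the event is \<open>X > x0\<close>, where \<open>x0\<close> is the largest
  point with \<open>F x0 \<le> 1 - p\<close>, and continuity makes this an equality.
\<close>
lemma prob_marginal_tail:
  assumes X: "X \<in> borel_measurable M" and cont: "continuous_on UNIV (marginal_cdf M X)"
    and p: "0 < p" "p < 1"
  shows "prob {\<omega> \<in> space M. 1 - marginal_cdf M X (X \<omega>) < p} = p"
proof -
  define F where "F = marginal_cdf M X"
  interpret XD: real_distribution "distr M borel X" using X by (rule real_distribution_distr)
  have mono: "F a \<le> F b" if "a \<le> b" for a b using that by (simp add: F_def XD.cdf_nondecreasing)
  define S where "S = {x. F x \<le> 1 - p}"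
  have "\<forall>\<^sub>F x in at_top. 1 - p < F x"
    using XD.cdf_lim_at_top_prob p unfolding F_def by (intro order_tendstoD(1)) auto
  then obtain b where b: "1 - p < F b" by (auto simp: eventually_at_top_linorder)
  have "\<forall>\<^sub>F x in at_bot. F x < 1 - p"
    using XD.cdf_lim_at_bot p unfolding F_def by (intro order_tendstoD(2)) auto
  then obtain a where a: "F a < 1 - p" by (auto simp: eventually_at_bot_linorder)
  have bdd: "bdd_above S"
  proof (rule bdd_aboveI)
    fix x assume "x \<in> S"
    then show "x \<le> b" using b mono[of b x] by (force simp: S_def)
  qed
  have "a \<in> S" using a by (simp add: S_def)
  have "closed S"
    unfolding S_def using cont by (intro closed_Collect_le) (auto simp: F_def)
  then have x0: "Sup S \<in> S" using closed_contains_Sup[OF _ bdd] \<open>a \<in> S\<close> by blast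
  have "Sup S \<le> b" using x0 b mono[of b "Sup S"] by (force simp: S_def)
  have "\<exists>x\<ge>a. x \<le> b \<and> F x = 1 - p"
  proof (rule IVT')
    show "a \<le> b" using a b mono[of b a] by linarith
    show "continuous_on {a..b} F" using cont unfolding F_def by (rule continuous_on_subset) auto
  qed (use a b in auto)
  then obtain x1 where x1: "F x1 = 1 - p" by blast
  have "x1 \<le> Sup S" using x1 bdd by (intro cSup_upper) (auto simp: S_def)
  then have Fx0: "F (Sup S) = 1 - p" using mono[of x1 "Sup S"] x1 x0 by (simp add: S_def)
  have "{\<omega> \<in> space M. 1 - F (X \<omega>) < p} = space M - (X -` {..Sup S} \<inter> space M)"
  proof -
    have "1 - F x < p \<longleftrightarrow> \<not> x \<le> Sup S" for x
    proof
      show "\<not> x \<le> Sup S" if "1 - F x < p" using that Fx0 mono[of x "Sup S"] by auto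
      show "1 - F x < p" if "\<not> x \<le> Sup S"
        using that cSup_upper[OF _ bdd, of x] by (force simp: S_def)
    qed
    then show ?thesis by auto
  qed
  moreover have "X -` {..Sup S} \<inter> space M \<in> events" using X by (intro measurable_sets) auto
  moreover have "prob (X -` {..Sup S} \<inter> space M) = 1 - p"
    using Fx0 X unfolding F_def cdf_def2 by (simp add: measure_distr)
  ultimately show ?thesis by (simp add: prob_compl F_def)
qed

lemma pareto_tail_diagonal:
  assumes X: "X \<in> borel_measurable M" and Y: "Y \<in> borel_measurable M" and t: "0 < t" "0 < x"
  shows "pareto_tail M X Y t x x = prob {\<omega> \<in> space M.
     1 - marginal_cdf M X (X \<omega>) < x / t \<and> 1 - marginal_cdf M Y (Y \<omega>) < x / t}"
proof -
  have iff: "ereal t / ereal x < 1 / ereal (1 - u) \<longleftrightarrow> 1 - u < x / t" if "u \<le> 1" for u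
  proof (cases "u = 1")
    case True
    then show ?thesis using t by (simp add: one_ereal_def)
  next
    case False
    then show ?thesis using t that by (simp add: one_ereal_def field_simps)
  qed
  have "{\<omega> \<in> space M.
     1 / ereal (1 - marginal_cdf M X (X \<omega>)) > ereal t / ereal x \<and>
     1 / ereal (1 - marginal_cdf M Y (Y \<omega>)) > ereal t / ereal x} = {\<omega> \<in> space M.
     1 - marginal_cdf M X (X \<omega>) < x / t \<and> 1 - marginal_cdf M Y (Y \<omega>) < x / t}"
    using iff marginal_cdf_le_1[OF X] marginal_cdf_le_1[OF Y] by auto
  then show ?thesis by (simp add: pareto_tail_def)
qed

lemma joint_tail_asymptotics:
  assumes SO: "SO M X Y c K \<beta> \<eta> \<tau>" and x: "0 < x"
  shows "((\<lambda>t. pareto_tail M X Y t x x / alpha M X Y t) \<longlongrightarrow> x powr (1 / \<eta>)) at_top"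
proof -
  have "((\<lambda>t. (pareto_tail M X Y t x x / alpha M X Y t - c x x) / \<beta> t) \<longlongrightarrow> K x x) at_top"
  proof -
    have "\<forall>x\<ge>0. \<forall>y\<ge>0. x + y > 0 \<longrightarrow>
       ((\<lambda>t. (pareto_tail M X Y t x y / alpha M X Y t - c x y) / \<beta> t) \<longlongrightarrow> K x y) at_top"
      using SO unfolding SO_def by blast
    then show ?thesis using x by simp
  qed
  moreover have "(\<beta> \<longlongrightarrow> 0) at_top" using SO by (simp add: SO_def)
  moreover have "\<forall>\<^sub>F t in at_top. \<beta> t \<noteq> 0"
  proof -
    have "(\<forall>\<^sub>F t in at_top. \<beta> t > 0) \<or> (\<forall>\<^sub>F t in at_top. \<beta> t < 0)" using SO unfolding SO_def by blast
    then show ?thesis by (auto elim: eventually_mono)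
  qed
  ultimately have "((\<lambda>t. pareto_tail M X Y t x x / alpha M X Y t) \<longlongrightarrow> c x x) at_top"
    by (rule tendsto_of_quotient_tendsto)
  then show ?thesis using SO x by (simp add: SO_def)
qed

end

context prob_space
begin

text \<open>
  Each bound needs marginal counts at a probability \<open>p\<close> and a pseudo-value \<open>v\<close> for which \<open>1/v\<close> differs
  from \<open>p\<close> by a factor \<open>2\<close>, so that the \<open>25\<close> percent fluctuations of the counts do no harm: \<open>p = 4 / s\<close>
  with \<open>1/v = 2 p\<close> for the lower bound, \<open>p = 1 / (8 s)\<close> with \<open>1/v = p / 2\<close> for the upper one.  The expected joint
  counts are then asymptotically \<open>4 powr (1/\<eta>) * m \<ge> 4 m\<close> and \<open>(1/8) powr (1/\<eta>) * m \<le> m / 8\<close>,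
  because \<open>\<eta> \<le> 1\<close>, and so the actual counts lie above \<open>m\<close> and below \<open>m / 2\<close>.
\<close>
lemma order_stats_pseudo_T_bounds:
  fixes m :: "nat \<Rightarrow> nat" and s :: "nat \<Rightarrow> real"
  assumes X: "X \<in> borel_measurable M" and Y: "Y \<in> borel_measurable M"
    and contX: "continuous_on UNIV (marginal_cdf M X)"
    and contY: "continuous_on UNIV (marginal_cdf M Y)"
    and indep: "indep_vars (\<lambda>i. borel) (\<lambda>i \<omega>. (Xs i \<omega>, Ys i \<omega>)) {1..}"
    and law: "\<And>i. i \<ge> 1 \<Longrightarrow> joint_law M (Xs i) (Ys i) = joint_law M X Y"
    and SO: "SO M X Y c K \<beta> \<eta> \<tau>"
    and s: "filterlim s at_top sequentially"
    and m: "\<And>n. 1 \<le> n \<Longrightarrow> 0 < m n \<and> real (m n) = real n * alpha M X Y (s n)"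
    and m_top: "filterlim (\<lambda>n. real (m n)) at_top sequentially"
  shows "\<exists>G. (\<forall>n. G n \<in> events) \<and> (\<lambda>n. prob (G n)) \<longlonglongrightarrow> 1 \<and>
    (\<forall>\<^sub>F n in sequentially. m n < n \<and> (\<forall>\<omega>\<in>G n.
       s n / 8 < order_stat n (pseudo_T n (\<lambda>i. Xs i \<omega>) (\<lambda>i. Ys i \<omega>)) (n - m n) \<and>
       order_stat n (pseudo_T n (\<lambda>i. Xs i \<omega>) (\<lambda>i. Ys i \<omega>)) (n - m n div 2) \<le> 16 * s n))"
proof -
  define F where "F = marginal_cdf M X"
  define H where "H = marginal_cdf M Y"
  define \<mu> where "\<mu> = joint_law M X Y"
  define DX where "DX = (\<lambda>p. {w :: real \<times> real. 1 - F (fst w) < p})"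
  define DY where "DY = (\<lambda>p. {w :: real \<times> real. 1 - H (snd w) < p})"
  define D where "D = (\<lambda>p. {w :: real \<times> real. 1 - F (fst w) < p \<and> 1 - H (snd w) < p})"
  have XY: "(\<lambda>\<omega>. (X \<omega>, Y \<omega>)) \<in> borel_measurable M" using X Y by (rule borel_measurable_Pair)
  have FH: "mono F" "mono H"
    using X Y real_distribution_distr real_distribution.axioms(1)
    unfolding F_def H_def mono_def
    by (auto intro!: finite_borel_measure.cdf_nondecreasing real_distribution.finite_borel_measure_M)
  have [measurable]: "(\<lambda>w :: real \<times> real. F (fst w)) \<in> borel_measurable borel"
      "(\<lambda>w :: real \<times> real. H (snd w)) \<in> borel_measurable borel"
    unfolding F_def H_def
    by (rule measurable_compose[OF _ marginal_cdf_measurable[OF X]] measurable_compose[OF _ marginal_cdf_measurable[OF Y]],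
        intro borel_measurable_continuous_onI continuous_intros)+
  have mD: "DX p \<in> sets borel" "DY p \<in> sets borel" "D p \<in> sets borel" for p
    unfolding DX_def DY_def D_def by measurable
  interpret mu: prob_space \<mu> unfolding \<mu>_def joint_law_def using XY by (rule prob_space_distr)
  have sets_mu: "sets \<mu> = sets borel" by (simp add: \<mu>_def joint_law_def)
  have measure_mu: "measure \<mu> E = prob {\<omega> \<in> space M. (X \<omega>, Y \<omega>) \<in> E}" if "E \<in> sets borel" for E
    using that XY unfolding \<mu>_def joint_law_def
    by (simp add: measure_distr vimage_def Int_def conj_commute)
  have muX: "measure \<mu> (DX p) = p" "measure \<mu> (DY p) = p" if "0 < p" "p < 1" for p
    using prob_marginal_tail[OF X contX that] prob_marginal_tail[OF Y contY that]
    by (simp_all add: measure_mu mD) (simp_all add: DX_def DY_def F_def H_def)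
  have muD: "measure \<mu> (D (x / t)) = pareto_tail M X Y t x x" if "0 < t" "0 < x" for x t
    using that by (simp add: measure_mu mD pareto_tail_diagonal[OF X Y]) (simp add: D_def F_def H_def)
  have le: "measure \<mu> (D p) \<le> measure \<mu> (DX p)" "measure \<mu> (D p) \<le> measure \<mu> (DY p)" for p
    using mD by (auto intro!: mu.finite_measure_mono simp: sets_mu D_def DX_def DY_def)

  have s16: "\<forall>\<^sub>F n in sequentially. 16 \<le> s n" using s by (simp add: filterlim_at_top)
  have ratio: "(\<lambda>n. real n * measure \<mu> (D (x / s n)) / real (m n)) \<longlonglongrightarrow> x powr (1 / \<eta>)" if x: "0 < x" for x
  proof (rule Lim_transform_eventually)
    show "(\<lambda>n. pareto_tail M X Y (s n) x x / alpha M X Y (s n)) \<longlonglongrightarrow> x powr (1 / \<eta>)"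
      by (rule filterlim_compose[OF joint_tail_asymptotics[OF SO x] s])
    show "\<forall>\<^sub>F n in sequentially. pareto_tail M X Y (s n) x x / alpha M X Y (s n)
        = real n * measure \<mu> (D (x / s n)) / real (m n)"
      using s16 eventually_ge_at_top[of "1::nat"]
      by eventually_elim (use m x in \<open>auto simp: muD\<close>)
  qed
  have D_top: "filterlim (\<lambda>n. real n * measure \<mu> (D (x / s n))) at_top sequentially" if x: "0 < x" for x
  proof -
    have "filterlim (\<lambda>n. real n * measure \<mu> (D (x / s n)) / real (m n) * real (m n)) at_top sequentially"
      using x by (intro filterlim_tendsto_pos_mult_at_top[OF ratio[OF x] _ m_top]) auto
    moreover have "\<forall>\<^sub>F n in sequentially. real n * measure \<mu> (D (x / s n)) / real (m n) * real (m n)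
        = real n * measure \<mu> (D (x / s n))"
      using eventually_ge_at_top[of "1::nat"] by eventually_elim (use m in force)
    ultimately show ?thesis using filterlim_cong by fast
  qed
  have DX_top: "filterlim (\<lambda>n. real n * measure \<mu> (DX (x / s n))) at_top sequentially"
      "filterlim (\<lambda>n. real n * measure \<mu> (DY (x / s n))) at_top sequentially" if x: "0 < x" for x
    by (rule filterlim_at_top_mono[OF D_top[OF x]], intro always_eventually allI mult_left_mono le, simp)+

  note conc = count_concentration[OF indep law[unfolded joint_law_def \<mu>_def[unfolded joint_law_def, symmetric]]]
  obtain GX where GX: "\<And>n. GX n \<in> events" "(\<lambda>n. prob (GX n)) \<longlonglongrightarrow> 1"
    "\<And>n \<omega>. \<omega> \<in> GX n \<Longrightarrow> \<bar>real (card {i \<in> {1..n}. (Xs i \<omega>, Ys i \<omega>) \<in> DX (4 / s n)}) - real n * measure \<mu> (DX (4 / s n))\<bar>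
        \<le> real n * measure \<mu> (DX (4 / s n)) / 4"
    using conc[OF _ mD(1) DX_top(1), of 4] by auto
  obtain GY where GY: "\<And>n. GY n \<in> events" "(\<lambda>n. prob (GY n)) \<longlonglongrightarrow> 1"
    "\<And>n \<omega>. \<omega> \<in> GY n \<Longrightarrow> \<bar>real (card {i \<in> {1..n}. (Xs i \<omega>, Ys i \<omega>) \<in> DY (4 / s n)}) - real n * measure \<mu> (DY (4 / s n))\<bar>
        \<le> real n * measure \<mu> (DY (4 / s n)) / 4"
    using conc[OF _ mD(2) DX_top(2), of 4] by auto
  obtain GD where GD: "\<And>n. GD n \<in> events" "(\<lambda>n. prob (GD n)) \<longlonglongrightarrow> 1"
    "\<And>n \<omega>. \<omega> \<in> GD n \<Longrightarrow> \<bar>real (card {i \<in> {1..n}. (Xs i \<omega>, Ys i \<omega>) \<in> D (4 / s n)}) - real n * measure \<mu> (D (4 / s n))\<bar>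
        \<le> real n * measure \<mu> (D (4 / s n)) / 4"
    using conc[OF _ mD(3) D_top, of 4] by auto
  obtain HX where HX: "\<And>n. HX n \<in> events" "(\<lambda>n. prob (HX n)) \<longlonglongrightarrow> 1"
    "\<And>n \<omega>. \<omega> \<in> HX n \<Longrightarrow> \<bar>real (card {i \<in> {1..n}. (Xs i \<omega>, Ys i \<omega>) \<in> DX (1/8 / s n)}) - real n * measure \<mu> (DX (1/8 / s n))\<bar>
        \<le> real n * measure \<mu> (DX (1/8 / s n)) / 4"
    using conc[OF _ mD(1) DX_top(1), of "1/8"] by auto
  obtain HY where HY: "\<And>n. HY n \<in> events" "(\<lambda>n. prob (HY n)) \<longlonglongrightarrow> 1"
    "\<And>n \<omega>. \<omega> \<in> HY n \<Longrightarrow> \<bar>real (card {i \<in> {1..n}. (Xs i \<omega>, Ys i \<omega>) \<in> DY (1/8 / s n)}) - real n * measure \<mu> (DY (1/8 / s n))\<bar>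
        \<le> real n * measure \<mu> (DY (1/8 / s n)) / 4"
    using conc[OF _ mD(2) DX_top(2), of "1/8"] by auto
  obtain HD where HD: "\<And>n. HD n \<in> events" "(\<lambda>n. prob (HD n)) \<longlonglongrightarrow> 1"
    "\<And>n \<omega>. \<omega> \<in> HD n \<Longrightarrow> \<bar>real (card {i \<in> {1..n}. (Xs i \<omega>, Ys i \<omega>) \<in> D (1/8 / s n)}) - real n * measure \<mu> (D (1/8 / s n))\<bar>
        \<le> real n * measure \<mu> (D (1/8 / s n)) / 4"
    using conc[OF _ mD(3) D_top, of "1/8"] by auto
  define G where "G = (\<lambda>n. GX n \<inter> (GY n \<inter> (GD n \<inter> (HX n \<inter> (HY n \<inter> HD n)))))"
  have G: "G n \<in> events" for n unfolding G_def by (intro sets.Int GX GY GD HX HY HD)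
  have probG: "(\<lambda>n. prob (G n)) \<longlonglongrightarrow> 1"
    unfolding G_def by (intro tendsto_prob_Int sets.Int GX GY GD HX HY HD)

  have \<eta>: "1 \<le> 1 / \<eta>" using SO by (auto simp: SO_def)
  have "2 < (4::real) powr (1 / \<eta>)" using powr_mono[OF \<eta>, of 4] by simp
  then have r4: "\<forall>\<^sub>F n in sequentially. 2 < real n * measure \<mu> (D (4 / s n)) / real (m n)"
    using ratio[of 4] by (intro order_tendstoD(1)) auto
  have "(1/8::real) powr (1 / \<eta>) < 1 / 4" using powr_mono'[OF \<eta>, of "1/8"] by simp
  then have r8: "\<forall>\<^sub>F n in sequentially. real n * measure \<mu> (D (1/8 / s n)) / real (m n) < 1 / 4"
    using ratio[of "1/8"] by (intro order_tendstoD(2)) auto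
  have "(alpha M X Y \<longlongrightarrow> 0) at_top" using SO by (simp add: SO_def)
  then have a1: "\<forall>\<^sub>F n in sequentially. alpha M X Y (s n) < 1"
    using filterlim_compose[OF _ s] order_tendstoD(2) zero_less_one by blast
  have "\<forall>\<^sub>F n in sequentially. m n < n \<and> (\<forall>\<omega>\<in>G n.
       s n / 8 < order_stat n (pseudo_T n (\<lambda>i. Xs i \<omega>) (\<lambda>i. Ys i \<omega>)) (n - m n) \<and>
       order_stat n (pseudo_T n (\<lambda>i. Xs i \<omega>) (\<lambda>i. Ys i \<omega>)) (n - m n div 2) \<le> 16 * s n)"
    using s16 r4 r8 a1 eventually_ge_at_top[of "1::nat"]
  proof eventually_elim
    case (elim n)
    have m0: "0 < m n" and "real (m n) = real n * alpha M X Y (s n)" using m elim by auto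
    moreover have "real n * alpha M X Y (s n) < real n * 1"
      using elim by (intro mult_strict_left_mono) auto
    ultimately have mn: "m n < n" by simp
    have sn: "0 < s n" using elim by simp
    have p4: "measure \<mu> (DX (4 / s n)) = 4 / s n" "measure \<mu> (DY (4 / s n)) = 4 / s n"
      using elim by (auto intro!: muX)
    have p8: "measure \<mu> (DX (1/8 / s n)) = 1/8 / s n" "measure \<mu> (DY (1/8 / s n)) = 1/8 / s n"
      using elim by (auto intro!: muX)
    show ?case
    proof (intro conjI ballI mn)
      fix \<omega> assume "\<omega> \<in> G n"
      then have om: "\<omega> \<in> GX n" "\<omega> \<in> GY n" "\<omega> \<in> GD n" "\<omega> \<in> HX n" "\<omega> \<in> HY n" "\<omega> \<in> HD n"
        by (auto simp: G_def)
      note cards = GX(3)[OF om(1), unfolded p4] GY(3)[OF om(2), unfolded p4] GD(3)[OF om(3)]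
        HX(3)[OF om(4), unfolded p8] HY(3)[OF om(5), unfolded p8] HD(3)[OF om(6)]
      note cards' = cards[unfolded DX_def DY_def mem_Collect_eq fst_conv snd_conv]
      have near: "a \<le> e + e / 4" and near': "3 / 4 * e \<le> a" if "\<bar>a - e\<bar> \<le> e / 4" for a e :: real
        using that by linarith+
      have up: "real c < (real n + 1) / (s n / 8)" if "\<bar>real c - real n * (4 / s n)\<bar> \<le> real n * (4 / s n) / 4" for c
      proof -
        have "real c \<le> real n * (4 / s n) + real n * (4 / s n) / 4" by (rule near[OF that])
        also have "\<dots> = 5 * real n / s n" by simp
        also have "\<dots> < 8 * (real n + 1) / s n" using sn by (intro divide_strict_right_mono) auto
        finally show ?thesis by (simp add: mult.commute)
      qed
      have low: "(real n + 1) / (16 * s n) \<le> real c + 1"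
        if "\<bar>real c - real n * (1/8 / s n)\<bar> \<le> real n * (1/8 / s n) / 4" for c
      proof -
        have "(real n + 1) / (16 * s n) \<le> 3 / 4 * (real n * (1/8 / s n)) + 1"
        proof -
          have "real n / (16 * s n) \<le> 3 / 4 * (real n * (1/8 / s n))" and "1 / (16 * s n) \<le> 1"
            using sn elim by (simp_all add: field_simps)
          then show ?thesis by (simp only: add_divide_distrib)
        qed
        also have "\<dots> \<le> real c + 1" using near'[OF that] by simp
        finally show ?thesis .
      qed
      have k4: "2 * real (m n) < real n * measure \<mu> (D (4 / s n))"
        and k8: "real n * measure \<mu> (D (1/8 / s n)) < real (m n) / 4"
        using elim m0 by (simp_all add: field_simps)
      have "real (m n) < real (card {i \<in> {1..n}. (Xs i \<omega>, Ys i \<omega>) \<in> D (4 / s n)})"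
        using near'[OF cards(3)] k4 by linarith
      then have c4: "m n < card {i \<in> {1..n}. 1 - F (Xs i \<omega>) < 4 / s n \<and> 1 - H (Ys i \<omega>) < 4 / s n}"
        by (simp add: D_def)
      have "real (2 * card {i \<in> {1..n}. (Xs i \<omega>, Ys i \<omega>) \<in> D (1/8 / s n)}) \<le> real (m n)"
        using near[OF cards(6)] k8 by simp
      then have "2 * card {i \<in> {1..n}. 1 - F (Xs i \<omega>) < 1/8 / s n \<and> 1 - H (Ys i \<omega>) < 1/8 / s n} \<le> m n"
        unfolding of_nat_le_iff by (simp add: D_def)
      then have c8: "card {i \<in> {1..n}. 1 - F (Xs i \<omega>) < 1/8 / s n \<and> 1 - H (Ys i \<omega>) < 1/8 / s n} \<le> m n div 2"
        by linarith
      show "s n / 8 < order_stat n (pseudo_T n (\<lambda>i. Xs i \<omega>) (\<lambda>i. Ys i \<omega>)) (n - m n)"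
        by (rule order_stat_pseudo_T_gt[OF FH _ up[OF cards'(1)] up[OF cards'(2)] mn c4]) (use sn in simp)
      show "order_stat n (pseudo_T n (\<lambda>i. Xs i \<omega>) (\<lambda>i. Ys i \<omega>)) (n - m n div 2) \<le> 16 * s n"
        by (rule order_stat_pseudo_T_le[OF FH _ low[OF cards'(4)] low[OF cards'(5)] _ c8]) (use sn mn in auto)
    qed
  qed
  with G probG show ?thesis by blast
qed

end

section \<open>Asymptotic equivalence\<close>

theorem theorem2p1:
  fixes M :: "'a measure"
    and X Y :: "'a \<Rightarrow> real"
    and Xs Ys :: "nat \<Rightarrow> 'a \<Rightarrow> real"
    and R c K :: "real \<Rightarrow> real \<Rightarrow> real"
    and \<beta> B :: "real \<Rightarrow> real"
    and \<eta> \<tau> lam q :: real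
    and k r :: "nat \<Rightarrow> real"
    and m :: "nat \<Rightarrow> nat"
  assumes "prob_space M"
    and "X \<in> borel_measurable M" and "Y \<in> borel_measurable M"
    and "continuous_on UNIV (marginal_cdf M X)"
    and "continuous_on UNIV (marginal_cdf M Y)"
    and "in_max_domain_of_attraction (joint_law M X Y)"
    and "limit_R M X Y R"
    and "prob_space.indep_vars M (\<lambda>i. borel) (\<lambda>i \<omega>. (Xs i \<omega>, Ys i \<omega>)) {1..}"
    and "\<And>i. i \<ge> 1 \<Longrightarrow> joint_law M (Xs i) (Ys i) = joint_law M X Y"
    and "SO M X Y c K \<beta> \<eta> \<tau>"
    and "((\<lambda>t. t * alpha M X Y t) \<longlongrightarrow> lam) at_top"
    and "second_order_V_star M X Y B \<eta> (min \<eta> \<tau>)"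
    and "\<And>n. r n = real n * alpha M X Y (real n / k n)"
    and "\<And>n. n \<ge> 1 \<Longrightarrow> r n > 0 \<and> r n \<in> \<nat>"
    and "filterlim r at_top sequentially"
    and "filterlim (\<lambda>n. real n / k n) at_top sequentially"
    and "\<And>n. m n = nat \<lfloor>r n\<rfloor>"
    and "(\<lambda>n. sqrt (real (m n)) * B (real n / real (m n))) \<longlonglongrightarrow> 0"
    and "q > 0"
  shows "converges_in_prob M
    (\<lambda>n \<omega>. sqrt (real (m n)) *
       \<bar>eta_estimator q n (m n) (pseudo_Z n (\<lambda>i. Xs i \<omega>) (\<lambda>i. Ys i \<omega>))
        - eta_estimator q n (m n) (pseudo_T n (\<lambda>i. Xs i \<omega>) (\<lambda>i. Ys i \<omega>))\<bar>) 0"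
proof -
  interpret prob_space M by fact
  note XY = assms(2,3)
  note so = assms(10)
  define s where "s = (\<lambda>n. real n / k n)"
  have s: "filterlim s at_top sequentially" unfolding s_def by fact
  have \<eta>: "0 < \<eta>" and lim: "(alpha M X Y \<longlongrightarrow> 0) at_top" using so by (auto simp: SO_def)
  have m: "0 < m n \<and> real (m n) = real n * alpha M X Y (s n)" if "1 \<le> n" for n
  proof -
    have "r n \<in> \<nat>" using assms(14)[OF that] by simp
    then obtain j where j: "r n = real j" by (auto elim: Nats_cases)
    then have "real (m n) = r n" using assms(17)[of n] by simp
    then show ?thesis using assms(14)[OF that] assms(13)[of n] by (simp add: s_def)
  qed
  have "\<forall>\<^sub>F n in sequentially. r n = real (m n)"
    using eventually_ge_at_top[of "1::nat"] by eventually_elim (use m assms(13) in \<open>simp add: s_def\<close>)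
  then have m_top: "filterlim (\<lambda>n. real (m n)) at_top sequentially"
    using assms(15) filterlim_cong by fast
  obtain G where G: "\<And>n. G n \<in> events" "(\<lambda>n. prob (G n)) \<longlonglongrightarrow> 1"
    and bounds: "\<forall>\<^sub>F n in sequentially. m n < n \<and> (\<forall>\<omega>\<in>G n.
       s n / 8 < order_stat n (pseudo_T n (\<lambda>i. Xs i \<omega>) (\<lambda>i. Ys i \<omega>)) (n - m n) \<and>
       order_stat n (pseudo_T n (\<lambda>i. Xs i \<omega>) (\<lambda>i. Ys i \<omega>)) (n - m n div 2) \<le> 16 * s n)"
    using order_stats_pseudo_T_bounds[OF XY assms(4,5,8,9) so s m m_top] by blast
  define C where "C = 4 * 128 powr \<bar>1 - 1 / q\<bar> * 128"
  have "(\<lambda>n. sqrt (real (m n)) / (s n)\<^sup>2) \<longlonglongrightarrow> 0"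
    by (rule sqrt_over_threshold_square_tendsto_0[OF XY lim assms(12) _ \<eta> s m assms(18)]) auto
  from tendsto_mult[OF tendsto_const[of C] this]
  have C0: "(\<lambda>n. C * (sqrt (real (m n)) / (s n)\<^sup>2)) \<longlonglongrightarrow> 0" by simp
  have s2: "filterlim (\<lambda>n. (s n)\<^sup>2) at_top sequentially"
    using s by (intro filterlim_pow_at_top) auto
  have "(\<lambda>n. \<bar>1 - 1 / q\<bar> * (128 / (s n)\<^sup>2)) \<longlonglongrightarrow> 0"
    by (intro tendsto_mult_right_zero real_tendsto_divide_at_top[OF tendsto_const s2])
  then have small: "\<forall>\<^sub>F n in sequentially. \<bar>1 - 1 / q\<bar> * (128 / (s n)\<^sup>2) < 1"
    by (intro order_tendstoD(2)) auto
  have s16: "\<forall>\<^sub>F n in sequentially. 16 \<le> s n" using s by (simp add: filterlim_at_top)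
  define \<Delta> where "\<Delta> = (\<lambda>n \<omega>. sqrt (real (m n)) *
       \<bar>eta_estimator q n (m n) (pseudo_Z n (\<lambda>i. Xs i \<omega>) (\<lambda>i. Ys i \<omega>))
        - eta_estimator q n (m n) (pseudo_T n (\<lambda>i. Xs i \<omega>) (\<lambda>i. Ys i \<omega>))\<bar>)"
  have "(\<lambda>n. prob {\<omega> \<in> space M. \<bar>\<Delta> n \<omega> - 0\<bar> > \<epsilon>}) \<longlonglongrightarrow> 0" if e: "0 < \<epsilon>" for \<epsilon>
  proof (rule tendsto_sandwich[where f = "\<lambda>_. 0" and h = "\<lambda>n. 1 - prob (G n)"])
    have "\<forall>\<^sub>F n in sequentially. C * (sqrt (real (m n)) / (s n)\<^sup>2) < \<epsilon>"
      using C0 e by (rule order_tendstoD(2))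
    with bounds small s16 eventually_ge_at_top[of "1::nat"]
    show "\<forall>\<^sub>F n in sequentially. prob {\<omega> \<in> space M. \<bar>\<Delta> n \<omega> - 0\<bar> > \<epsilon>} \<le> 1 - prob (G n)"
    proof eventually_elim
      case (elim n)
      have "\<bar>\<Delta> n \<omega> - 0\<bar> \<le> \<epsilon>" if "\<omega> \<in> G n" for \<omega>
      proof -
        have "\<Delta> n \<omega> \<le> sqrt (real (m n)) * (4 * 128 powr \<bar>1 - 1 / q\<bar> * (128 / (s n)\<^sup>2))"
          unfolding \<Delta>_def
          by (intro mult_left_mono estimator_difference_bound) (use elim that m[of n] \<open>q > 0\<close> in auto)
        also have "\<dots> = C * (sqrt (real (m n)) / (s n)\<^sup>2)" by (simp add: C_def)
        also have "\<dots> < \<epsilon>" by (rule elim)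
        finally show ?thesis by (simp add: \<Delta>_def)
      qed
      then have "{\<omega> \<in> space M. \<bar>\<Delta> n \<omega> - 0\<bar> > \<epsilon>} \<subseteq> space M - G n" by force
      then have "prob {\<omega> \<in> space M. \<bar>\<Delta> n \<omega> - 0\<bar> > \<epsilon>} \<le> prob (space M - G n)"
        using G(1) by (intro finite_measure_mono) auto
      then show ?case using G(1) by (simp add: prob_compl)
    qed
    show "(\<lambda>n. 1 - prob (G n)) \<longlonglongrightarrow> 0" using G(2) by (auto intro!: tendsto_eq_intros)
  qed auto
  then show ?thesis unfolding converges_in_prob_def \<Delta>_def by blast
qed

end
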